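(* There is a randomized algorithm with the following guarantee. Let $G=(V,E,w)$ be a strongly connected weighted digraph with $n=|V|$ vertices, $m=|E|$ edges, unweighted diameter $d$, and edge weights in $[-w_{\max},w_{\max}]$, given through its edge oracle and weight oracle, and let $\varepsilon>0$. The algorithm outputs a cycle $\sigma$ in $G$ satisfying $\bar w(\sigma)\le \mu(G)+\varepsilon$, using $O(n)$ memory (beyond the oracles) and a random number $T$ of arithmetic operations, all performed on $O(\log(n w_{\max}/\varepsilon))$-bit numbers, where (i) $\mathbb{E}[T]=O\!\left(m d^2 (w_{\max}/\varepsilon)^2\log n\right)$, and (ii) for every $\alpha\in(0,1)$, $\mathbb{P}\!\left(T\le O\!\left(m d^2 (w_{\max}/\varepsilon)^2\log n\,\log(1/\alpha)\right)\right)\ge 1-\alpha$.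
   Context: A weighted digraph $G=(V,E,w)$ has directed edges $E\subseteq V\times V$ and weights $w:E\to\mathbb{R}$. For a directed cycle $\sigma$, its mean weight is $\bar w(\sigma)=\frac{1}{|\sigma|}\sum_{e\in\sigma}w(e)$, and $\mu(G)=\min_{\text{cycle }\sigma}\bar w(\sigma)$ (the Min-Mean-Cycle value). $G$ is strongly connected if there is a directed path between every ordered pair of vertices; the unweighted diameter $d$ is the maximum over ordered pairs $(u,v)$ of the number of edges on a shortest directed path from $u$ to $v$. The input is accessed through two oracles, each query taking $O(1)$ time: an edge oracle that, given $i\in V$ and $k\in[n]$, returns the $k$-th incoming and the $k$-th outgoing edge of $i$ (in arbitrary fixed orders; null if $k$ exceeds the degree), and a weight oracle that, given $i,j\in V$, returns $w(i,j)$ if $(i,j)\in E$ and $\infty$ otherwise. Memory is counted as the number of stored numbers.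
   Formalization: In the O-bounds, d, w_max/ε, log n and log(1/α) (and w_max/ε and the logarithm in the bit bound) are replaced by their maximum with 1, since the literal bounds fail e.g. for w_max=0, n=1 or α→1; G is assumed to have at least one edge, so that μ(G) is defined. *)

theory Defs
  imports
    "HOL-Probability.SPMF"
    "HOL-Library.Log_Nat"
    "Graph_Theory.Pair_Digraph"
    "Graph_Theory.Digraph_Component"
begin

section \<open>Weighted digraphs\<close>

text \<open>
  Vertices are the numbers \<open>1, \<dots>, n\<close> and arcs are pairs of vertices, so there are no
  parallel arcs, but loops are allowed. Walks, paths and cycles are the arc lists of
  \<open>Graph_Theory\<close>; a cycle is nonempty and repeats no vertex.
\<close>

definition mean_weight :: "(nat \<times> nat \<Rightarrow> real) \<Rightarrow> (nat \<times> nat) list \<Rightarrow> real" where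
  "mean_weight w p = (\<Sum>e\<leftarrow>p. w e) / real (length p)"

definition min_mean_cycle :: "nat pair_pre_digraph \<Rightarrow> (nat \<times> nat \<Rightarrow> real) \<Rightarrow> real" where
  "min_mean_cycle G w = Min {mean_weight w p |p. pre_digraph.cycle (with_proj G) p}"

definition hop_distance :: "nat pair_pre_digraph \<Rightarrow> nat \<Rightarrow> nat \<Rightarrow> nat" where
  "hop_distance G u v = (LEAST k. \<exists>p. pre_digraph.apath (with_proj G) u p v \<and> length p = k)"

definition hop_diameter :: "nat pair_pre_digraph \<Rightarrow> nat" where
  "hop_diameter G = Max {hop_distance G u v |u v. u \<in> pverts G \<and> v \<in> pverts G}"


section \<open>Oracles\<close>

type_synonym edge_oracle = "nat \<Rightarrow> nat \<Rightarrow> (nat \<times> nat) option \<times> (nat \<times> nat) option"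

text \<open>
  \<open>eo i k\<close> is the pair of the \<open>k\<close>-th incoming and the \<open>k\<close>-th outgoing arc of \<open>i\<close>, counted
  from 1, in some order; \<open>None\<close> stands for null. Nothing is assumed about queries
  outside \<open>i \<in> V\<close>, \<open>k \<in> {1..n}\<close>.
\<close>

definition is_edge_oracle :: "nat pair_pre_digraph \<Rightarrow> edge_oracle \<Rightarrow> bool" where
  "is_edge_oracle G eo \<longleftrightarrow> (\<forall>i \<in> pverts G.
     bij_betw (\<lambda>k. fst (eo i k)) {1..in_degree (with_proj G) i}
       (Some ` in_arcs (with_proj G) i) \<and>
     (\<forall>k \<in> {in_degree (with_proj G) i <.. card (pverts G)}. fst (eo i k) = None) \<and>
     bij_betw (\<lambda>k. snd (eo i k)) {1..out_degree (with_proj G) i}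
       (Some ` out_arcs (with_proj G) i) \<and>
     (\<forall>k \<in> {out_degree (with_proj G) i <.. card (pverts G)}. snd (eo i k) = None))"

type_synonym weight_oracle = "nat \<Rightarrow> nat \<Rightarrow> ereal"

definition weight_oracle_of ::
  "nat pair_pre_digraph \<Rightarrow> (nat \<times> nat \<Rightarrow> real) \<Rightarrow> weight_oracle" where
  "weight_oracle_of G w i j = (if (i, j) \<in> parcs G then ereal (w (i, j)) else \<infinity>)"


section \<open>A randomized random-access machine\<close>

text \<open>
  A memory cell holds a rational number (the only values on which arithmetic, comparison,
  addressing and random choice operate), null, or a raw extended real. Raw values enter the
  memory only as the input parameter and as answers of the weight oracle, and apart from
  copying and testing for infinity the only thing that can be done with them is to
  discretise them: \<open>Discretise a k s u\<close> stores the integer \<open>\<lfloor>k * s / u\<rfloor>\<close>, that is, it reads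
  the raw \<open>s\<close> in units of \<open>u / k\<close> for raw \<open>u \<noteq> 0\<close>. This is how weights of unlimited
  precision are turned into numbers of bounded length; measuring in units of a raw value
  keeps the model invariant under rescaling of the weights together with the accuracy.
\<close>

datatype cell = Num rat | Null | Raw ereal

text \<open>
  All operands are constant addresses, the destination coming first. \<open>Load a s\<close> and
  \<open>Store a s\<close> address indirectly: the number in \<open>s\<close>, respectively in \<open>a\<close>, is the address
  accessed. \<open>Random a s\<close> draws uniformly from \<open>{0..<N}\<close>, where \<open>N\<close> is the number in \<open>s\<close>.
  \<open>Query_Edge a b i k\<close> stores the other endpoints of the \<open>k\<close>-th incoming and
  of the \<open>k\<close>-th outgoing arc of \<open>i\<close>.
\<close>

datatype arith = Add | Sub | Mul | Div

datatype instr =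
    Const nat int
  | Move nat nat
  | Load nat nat
  | Store nat nat
  | Arith arith nat nat nat
  | Floor nat nat
  | Discretise nat nat nat nat
  | Random nat nat
  | Query_Edge nat nat nat nat
  | Query_Weight nat nat nat

datatype test = Less nat nat | Is_Null nat | Is_Inf nat

datatype com =
    Skip
  | Do instr
  | Seq com com
  | If test com com
  | While test com

text \<open>
  Memory is a partial map because the numbers stored are counted: cells are never released,
  so \<open>num_cells\<close> of a state is also the maximum over the execution so far. Similarly \<open>width\<close> is
  the largest bit length of a number that has been written so far, hence bounds the
  operands and results of all operations. \<open>steps\<close> counts every instruction and every test.
\<close>

record state =
  mem :: "nat \<rightharpoonup> cell"
  steps :: nat
  width :: nat

definition num_cells :: "state \<Rightarrow> nat" where
  "num_cells s = card (dom (mem s))"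

definition bit_length :: "rat \<Rightarrow> nat" where
  "bit_length q = (let (a, b) = quotient_of q in nat (1 + bitlen \<bar>a\<bar> + bitlen b))"

fun cell_width :: "cell \<Rightarrow> nat" where
  "cell_width (Num q) = bit_length q"
| "cell_width Null = 0"
| "cell_width (Raw x) = 0"

definition put :: "nat \<Rightarrow> cell \<Rightarrow> state \<Rightarrow> state" where
  "put a c s = s\<lparr>mem := (mem s)(a \<mapsto> c), width := max (width s) (cell_width c)\<rparr>"

definition tick :: "state \<Rightarrow> state" where
  "tick s = s\<lparr>steps := Suc (steps s)\<rparr>"

definition get_num :: "state \<Rightarrow> nat \<Rightarrow> rat option" where
  "get_num s a = (case mem s a of Some (Num q) \<Rightarrow> Some q | _ \<Rightarrow> None)"

definition get_nat :: "state \<Rightarrow> nat \<Rightarrow> nat option" where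
  "get_nat s a = (case get_num s a of
     Some q \<Rightarrow> if q \<in> \<nat> then Some (nat \<lfloor>q\<rfloor>) else None
   | None \<Rightarrow> None)"

definition get_raw :: "state \<Rightarrow> nat \<Rightarrow> real option" where
  "get_raw s a = (case mem s a of Some (Raw (ereal x)) \<Rightarrow> Some x | _ \<Rightarrow> None)"

fun arith_op :: "arith \<Rightarrow> rat \<Rightarrow> rat \<Rightarrow> rat option" where
  "arith_op Add x y = Some (x + y)"
| "arith_op Sub x y = Some (x - y)"
| "arith_op Mul x y = Some (x * y)"
| "arith_op Div x y = (if y = 0 then None else Some (x / y))"

text \<open>\<open>None\<close> means that the machine is stuck, for instance on an operand of the wrong kind.\<close>

fun det_instr :: "edge_oracle \<Rightarrow> weight_oracle \<Rightarrow> instr \<Rightarrow> state \<Rightarrow> state option" where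
  "det_instr eo wo (Const a z) s = Some (put a (Num (of_int z)) s)"
| "det_instr eo wo (Move a b) s = do { c \<leftarrow> mem s b; Some (put a c s) }"
| "det_instr eo wo (Load a b) s = do { l \<leftarrow> get_nat s b; c \<leftarrow> mem s l; Some (put a c s) }"
| "det_instr eo wo (Store a b) s = do { l \<leftarrow> get_nat s a; c \<leftarrow> mem s b; Some (put l c s) }"
| "det_instr eo wo (Arith f a b c) s = do {
     x \<leftarrow> get_num s b; y \<leftarrow> get_num s c; z \<leftarrow> arith_op f x y; Some (put a (Num z) s) }"
| "det_instr eo wo (Floor a b) s = do {
     x \<leftarrow> get_num s b; Some (put a (Num (of_int \<lfloor>x\<rfloor>)) s) }"
| "det_instr eo wo (Discretise a k b u) s = do {
     q \<leftarrow> get_num s k; x \<leftarrow> get_raw s b; y \<leftarrow> get_raw s u;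
     if y = 0 then None else Some (put a (Num (of_int \<lfloor>of_rat q * x / y\<rfloor>)) s) }"
| "det_instr eo wo (Query_Edge a b i k) s = do {
     v \<leftarrow> get_nat s i; l \<leftarrow> get_nat s k;
     let c_in = (case fst (eo v l) of None \<Rightarrow> Null | Some e \<Rightarrow> Num (of_nat (fst e)));
         c_out = (case snd (eo v l) of None \<Rightarrow> Null | Some e \<Rightarrow> Num (of_nat (snd e)))
     in Some (put b c_out (put a c_in s)) }"
| "det_instr eo wo (Query_Weight a i j) s = do {
     u \<leftarrow> get_nat s i; v \<leftarrow> get_nat s j; Some (put a (Raw (wo u v)) s) }"
| "det_instr eo wo (Random a b) s = None"

text \<open>The outcome is a subdistribution; the missing mass is that of stuck or infinite runs.\<close>

definition exec_instr ::
  "edge_oracle \<Rightarrow> weight_oracle \<Rightarrow> instr \<Rightarrow> state \<Rightarrow> state spmf" where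
  "exec_instr eo wo i s = (case i of
     Random a b \<Rightarrow> (case get_nat s b of
        None \<Rightarrow> return_pmf None
      | Some N \<Rightarrow> map_spmf (\<lambda>r. put a (Num (of_nat r)) s) (spmf_of_set {..<N}))
   | _ \<Rightarrow> return_pmf (det_instr eo wo i s))"

fun eval_test :: "test \<Rightarrow> state \<Rightarrow> bool option" where
  "eval_test (Less a b) s = do { x \<leftarrow> get_num s a; y \<leftarrow> get_num s b; Some (x < y) }"
| "eval_test (Is_Null a) s = map_option (\<lambda>c. c = Null) (mem s a)"
| "eval_test (Is_Inf a) s = map_option (\<lambda>c. c = Raw \<infinity>) (mem s a)"

partial_function (spmf) while_loop ::
  "(state \<Rightarrow> bool option) \<Rightarrow> (state \<Rightarrow> state spmf) \<Rightarrow> state \<Rightarrow> state spmf" where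
  "while_loop b body s = (case b s of
     None \<Rightarrow> return_pmf None
   | Some t \<Rightarrow> if t then bind_spmf (body (tick s)) (while_loop b body)
               else return_spmf (tick s))"

primrec exec :: "edge_oracle \<Rightarrow> weight_oracle \<Rightarrow> com \<Rightarrow> state \<Rightarrow> state spmf" where
  "exec eo wo Skip s = return_spmf s"
| "exec eo wo (Do i) s = exec_instr eo wo i (tick s)"
| "exec eo wo (Seq c1 c2) s = bind_spmf (exec eo wo c1 s) (exec eo wo c2)"
| "exec eo wo (If b c1 c2) s = (case eval_test b s of
     None \<Rightarrow> return_pmf None
   | Some t \<Rightarrow> if t then exec eo wo c1 (tick s) else exec eo wo c2 (tick s))"
| "exec eo wo (While b c) s = while_loop (eval_test b) (exec eo wo c) s"

text \<open>Initially cell 0 holds \<open>n\<close> and cell 1 the accuracy; the machine is given nothing else.\<close>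

definition initial_state :: "nat \<Rightarrow> real \<Rightarrow> state" where
  "initial_state n \<epsilon> =
     put 1 (Raw (ereal \<epsilon>)) (put 0 (Num (of_nat n))
       \<lparr>mem = Map.empty, steps = 0, width = 0\<rparr>)"

definition run :: "com \<Rightarrow> nat \<Rightarrow> real \<Rightarrow> edge_oracle \<Rightarrow> weight_oracle \<Rightarrow> state spmf" where
  "run P n \<epsilon> eo wo = exec eo wo P (initial_state n \<epsilon>)"

text \<open>
  The output is a cycle given by its vertices in order: cell 0 holds their number, and cell 1
  the address from which on they are stored.
\<close>

definition outputs :: "state \<Rightarrow> (nat \<times> nat) list \<Rightarrow> bool" where
  "outputs s \<sigma> \<longleftrightarrow> (\<exists>vs a.
     get_nat s 0 = Some (length vs) \<and> get_nat s 1 = Some a \<and>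
     (\<forall>i < length vs. get_nat s (a + i) = Some (vs ! i)) \<and>
     \<sigma> = zip vs (rotate1 vs))"

text \<open>
  In resource bounds, each factor of an \<open>O\<close>-expression is replaced by its maximum with 1:
  \<open>d\<close>, \<open>ln n\<close> and \<open>ln (1 / \<alpha>)\<close> can vanish or become arbitrarily small, as can
  \<open>w\<^sub>m\<^sub>a\<^sub>x / \<epsilon>\<close>, and then no algorithm meets the bound taken literally. For
  \<open>n \<ge> 3\<close>, \<open>w\<^sub>m\<^sub>a\<^sub>x \<ge> \<epsilon>\<close> and \<open>\<alpha> \<le> 1 / e\<close> nothing is changed.
\<close>

end

theory Submission
  imports Defs
begin

text \<open>
  Deterministic value iteration meets the bounds, so no randomness is used. Weights are
  rounded down to integers \<open>g\<close> in units of \<open>\<epsilon> / 2\<close>. For a horizon \<open>T = 2, 4, 8, \<dots>\<close> two Bellman-Ford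
  runs of \<open>T\<close> rounds are made. The first, with weights \<open>g - T\<close> and all potentials starting at 0,
  yields the minimal potential \<open>\<mu>\<close>; summing the relaxation inequalities along a cycle shows that
  every cycle has mean at least \<open>T + \<mu> / T\<close>. The second run uses weights that make the slightly
  larger value \<open>T + \<mu> / T + 1\<close> the new zero, starts at 0 in vertex 1 and at a large value
  elsewhere, and remembers for every vertex the successor that decreased it last. Along successor
  pointers the potential never drops by less than the weight, so a cycle of pointers has
  nonpositive weight, whatever \<open>T\<close> is, and is therefore a correct answer. Once \<open>T\<close> exceeds a
  multiple of \<open>d w\<^sub>m\<^sub>a\<^sub>x / \<epsilon>\<close>, the first run is accurate up to \<open>1 / 2\<close>, hence there is a closed walk of
  at most \<open>T\<close> arcs and negative weight through vertex 1; then all potentials, also that of vertex 1,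
  have decreased, every vertex has a pointer, and following pointers must lead into a cycle.
\<close>

section \<open>Walks and potentials\<close>

text \<open>The machine knows neither \<open>d\<close> nor \<open>wmax\<close>, so it cannot tell
  whether a horizon is long enough; doubling works because every answer is certified by potentials
  and a failure shows as a pointer walk that ends in 0. Success is forced from T = 8 d K on, where K
  = O(max 1 (wmax / \<epsilon>)) bounds |g|, so T never exceeds 16 d K. A run of T rounds costs O(m
  T), hence all attempts together cost O(m d K), a geometric series.

  Nothing is divided: the second run uses the weights \<open>T * g - M\<close>, with zero at M / T,
  so all numbers are integers of size O(T^3 K) apart from addresses, which gives logarithmic bit
  length. Potentials are minima over walks of at most T arcs. Subtracting T in the first run makes
  the minimal cycle mean nonpositive once T \<ge> K, and then shorter walks cannot spoil the
  estimate. The accuracy is shared equally: one unit \<epsilon> / 2 for rounding, one for the raised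
  zero.\<close>

lemma sum_list_map_ge:
  fixes h :: "'b \<Rightarrow> real"
  assumes "\<And>e. e \<in> set q \<Longrightarrow> c \<le> h e"
  shows "real (length q) * c \<le> sum_list (map h q)"
  using assms by (induction q) (auto simp: algebra_simps intro: add_mono)

lemma sum_list_map_le:
  fixes h :: "'b \<Rightarrow> real"
  assumes "\<And>e. e \<in> set q \<Longrightarrow> h e \<le> c"
  shows "sum_list (map h q) \<le> real (length q) * c"
  using assms by (induction q) (auto simp: algebra_simps intro: add_mono)

lemma sum_list_real_of_int:
  "real_of_int (sum_list (map h q)) = sum_list (map (\<lambda>e. real_of_int (h e)) q)"
  by (induction q) auto

lemma sum_list_map_const:
  fixes c :: int
  shows "sum_list (map (\<lambda>e. c) q) = int (length q) * c"
  by (induction q) (auto simp: algebra_simps)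

lemma sum_list_affine:
  fixes g :: "'b \<Rightarrow> int"
  shows "sum_list (map (\<lambda>e. S * g e - M) q) = S * sum_list (map g q) - int (length q) * M"
  by (induction q) (auto simp: algebra_simps)

context pair_fin_digraph
begin

text \<open>A closed walk that is not a cycle repeats a vertex after its first arc. Cutting out the
  closed piece between two visits leaves two closed walks. The piece is nonempty and the first arc
  stays in the remainder, so both are strictly shorter.\<close>

lemma closed_awalk_sum_nonneg:
  fixes h :: "'a \<times> 'a \<Rightarrow> real"
  assumes cyc: "\<And>c. cycle c \<Longrightarrow> 0 \<le> sum_list (map h c)"
  shows "awalk u p u \<Longrightarrow> 0 \<le> sum_list (map h p)"
proof (induction "length p" arbitrary: p u rule: less_induct)
  case less
  show ?case
  proof (cases "p = [] \<or> cycle p")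
    case True
    then show ?thesis using cyc by auto
  next
    case False
    then have "p \<noteq> []" "\<not> distinct (tl (pawalk_verts u p))"
      using less.prems by (auto simp: cycle_def)
    then obtain e es where p: "p = e # es" and nd: "\<not> distinct (pawalk_verts (snd e) es)"
      by (cases p) auto
    have es: "awalk (snd e) es u" and e: "awalk u [e] (snd e)"
      using less.prems p by (auto simp: awalk_Cons_iff awalk_Nil_iff dest: arc_snd_in_verts)
    obtain q r s where d: "es = q @ r @ s" and r: "r \<noteq> []"
      and w: "\<exists>w. awalk (snd e) q w \<and> awalk w r w \<and> awalk w s u"
      using awalk_not_distinct_decomp[OF es nd] by blast
    then obtain w where w: "awalk (snd e) q w" "awalk w r w" "awalk w s u" by blast
    have "0 \<le> sum_list (map h r)"
      using less.hyps[OF _ w(2)] p d by simp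
    moreover have "awalk u ([e] @ q @ s) u"
      by (intro awalk_appendI[OF e] awalk_appendI[OF w(1)] w)
    then have "0 \<le> sum_list (map h ([e] @ q @ s))"
      using r by (intro less.hyps) (auto simp: p d)
    ultimately show ?thesis by (simp add: p d)
  qed
qed

text \<open>For \<open>u = v\<close>, the case in which it is applied, tails and heads of a closed
  walk carry the same total potential.\<close>

lemma awalk_sum_telescope:
  fixes \<pi> :: "'a \<Rightarrow> int"
  shows "awalk u q v \<Longrightarrow> (\<Sum>e\<leftarrow>q. \<pi> (fst e)) + \<pi> v = \<pi> u + (\<Sum>e\<leftarrow>q. \<pi> (snd e))"
  by (induction q arbitrary: u) (auto simp: awalk_Cons_iff awalk_Nil_iff)

lemma finite_cycles: "finite {c. cycle c}"
  by (rule finite_subset[OF _ finite_subset_distinct[OF pair_finite_arcs]])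
    (auto simp: cycle_conv)

lemma exists_cycle_min_mean:
  fixes g :: "'a \<times> 'a \<Rightarrow> int"
  assumes "cycle c0"
  obtains \<nu> :: real and c where "cycle c" "real_of_int (sum_list (map g c)) = \<nu> * length c"
    "\<And>c. cycle c \<Longrightarrow> \<nu> * length c \<le> real_of_int (sum_list (map g c))"
proof -
  let ?mean = "\<lambda>c. real_of_int (sum_list (map g c)) / length c"
  obtain c where c: "cycle c" and min: "\<And>c'. cycle c' \<Longrightarrow> ?mean c \<le> ?mean c'"
    using ex_min_if_finite[of "?mean ` {c. cycle c}"] finite_cycles assms
    by (force simp: not_less)
  show ?thesis
  proof
    show "cycle c" by fact
    show "real_of_int (sum_list (map g c)) = ?mean c * length c"
      using c by (auto simp: cycle_def)
    show "?mean c * length c' \<le> real_of_int (sum_list (map g c'))" if "cycle c'" for c'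
      using min[OF that] that by (auto simp: cycle_def field_simps)
  qed
qed

section \<open>Potentials of value iteration\<close>

definition relax :: "('a \<times> 'a \<Rightarrow> int) \<Rightarrow> ('a \<Rightarrow> int) \<Rightarrow> 'a \<Rightarrow> int" where
  "relax r p v = Min (insert (p v) ((\<lambda>u. r (v, u) + p u) ` (parcs G `` {v})))"

abbreviation pot :: "('a \<times> 'a \<Rightarrow> int) \<Rightarrow> ('a \<Rightarrow> int) \<Rightarrow> nat \<Rightarrow> 'a \<Rightarrow> int" where
  "pot r p0 t \<equiv> (relax r ^^ t) p0"

lemma finite_succs: "finite (parcs G `` {v})"
  by (rule finite_subset[of _ "snd ` parcs G"]) (force intro: pair_finite_arcs)+

lemma relax_le: "relax r p v \<le> p v"
  by (simp add: relax_def finite_succs)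

lemma relax_le_arc: "(v, u) \<in> parcs G \<Longrightarrow> relax r p v \<le> r (v, u) + p u"
  unfolding relax_def by (rule Min_le) (auto simp: finite_succs)

lemma relax_cases:
  obtains "relax r p v = p v"
  | u where "(v, u) \<in> parcs G" "relax r p v = r (v, u) + p u"
  using Min_in[of "insert (p v) ((\<lambda>u. r (v, u) + p u) ` (parcs G `` {v}))"]
  unfolding relax_def by (auto simp: finite_succs)

lemma relax_eqI:
  assumes "b \<le> p v" "\<And>u. (v, u) \<in> parcs G \<Longrightarrow> b \<le> r (v, u) + p u"
    and "b = p v \<or> (\<exists>u. (v, u) \<in> parcs G \<and> b = r (v, u) + p u)"
  shows "b = relax r p v"
  unfolding relax_def using assms by (intro Min_eqI[symmetric]) (auto simp: finite_succs)

lemma pot_antimono: "t \<le> t' \<Longrightarrow> pot r p0 t' v \<le> pot r p0 t v"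
  by (induction t' rule: dec_induct) (auto intro: order_trans[OF relax_le])

text \<open>Heads and tails of a closed walk are the same vertices with multiplicity. Adding the
  relaxation inequality over its arcs shows that each round changes the sum of potentials by at most
  the weight of the walk.\<close>

lemma pot_closed_awalk_le:
  assumes "awalk u c u"
  shows "(\<Sum>e\<leftarrow>c. pot r p0 (s + t) (fst e)) \<le> (\<Sum>e\<leftarrow>c. pot r p0 t (fst e)) + int s * sum_list (map r c)"
proof (induction s)
  case (Suc s)
  have "(\<Sum>e\<leftarrow>c. pot r p0 (Suc s + t) (fst e)) \<le> (\<Sum>e\<leftarrow>c. r e + pot r p0 (s + t) (snd e))"
    using assms by (intro sum_list_mono) (auto simp: awalk_def intro!: relax_le_arc)
  also have "\<dots> = sum_list (map r c) + (\<Sum>e\<leftarrow>c. pot r p0 (s + t) (snd e))"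
    by (simp add: sum_list_addf)
  also have "(\<Sum>e\<leftarrow>c. pot r p0 (s + t) (snd e)) = (\<Sum>e\<leftarrow>c. pot r p0 (s + t) (fst e))"
    using awalk_sum_telescope[OF assms, of "pot r p0 (s + t)"] by simp
  finally show ?case using Suc by (simp add: algebra_simps)
qed simp

lemma pot_awalk_le:
  "awalk v q u \<Longrightarrow> pot r p0 (length q + t) v \<le> sum_list (map r q) + pot r p0 t u"
proof (induction q arbitrary: v)
  case (Cons e q)
  have "pot r p0 (length (e # q) + t) v \<le> r (v, snd e) + pot r p0 (length q + t) (snd e)"
    using Cons.prems relax_le_arc[of "fst e" "snd e"] by (auto simp: awalk_Cons_iff)
  also have "pot r p0 (length q + t) (snd e) \<le> sum_list (map r q) + pot r p0 t u"
    using Cons by (auto simp: awalk_Cons_iff)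
  finally show ?case using Cons.prems by (auto simp: awalk_Cons_iff)
qed (auto simp: awalk_Nil_iff)

text \<open>Since \<open>relax\<close> keeps \<open>p v\<close> among the candidates,
  \<open>pot r p0 t v\<close> is the minimum over walks with at most, not exactly, \<open>t\<close>
  arcs. This half produces a walk; the other half is \<open>pot_awalk_le\<close> together with
  \<open>pot_antimono\<close>.\<close>

lemma pot_attained:
  assumes "v \<in> pverts G"
  shows "\<exists>q u. awalk v q u \<and> length q \<le> t \<and> pot r p0 t v = sum_list (map r q) + p0 u"
  using assms
proof (induction t arbitrary: v)
  case 0
  then show ?case by (intro exI[of _ "[]"] exI[of _ v]) (auto simp: awalk_Nil_iff)
next
  case (Suc t)
  show ?case
  proof (cases rule: relax_cases[of r "pot r p0 t" v])
    case 1
    then show ?thesis using Suc.IH[OF Suc.prems] by (auto intro: le_SucI)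
  next
    case (2 u)
    then obtain q z where "awalk u q z" "length q \<le> t" "pot r p0 t u = sum_list (map r q) + p0 z"
      using Suc.IH[of u] by (auto dest: in_arcsD2)
    then show ?thesis using 2
      by (intro exI[of _ "(v, u) # q"] exI[of _ z]) (auto simp: awalk_Cons_iff)
  qed
qed

lemma pot_abs_le:
  assumes "\<And>e. e \<in> parcs G \<Longrightarrow> \<bar>r e\<bar> \<le> R" "\<And>u. u \<in> pverts G \<Longrightarrow> \<bar>p0 u\<bar> \<le> B" "v \<in> pverts G" "0 \<le> R"
  shows "\<bar>pot r p0 t v\<bar> \<le> B + int t * R"
  using assms(3)
proof (induction t arbitrary: v)
  case (Suc t)
  show ?case
  proof (cases rule: relax_cases[of r "pot r p0 t" v])
    case 1
    then show ?thesis using Suc.IH[OF Suc.prems] assms(4) by (simp add: algebra_simps)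
  next
    case (2 u)
    then have "\<bar>pot r p0 t u\<bar> \<le> B + int t * R" "\<bar>r (v, u)\<bar> \<le> R"
      using Suc assms(1) by (auto dest: in_arcsD2)
    with 2 show ?thesis by (auto simp: algebra_simps)
  qed
qed (use assms in auto)

text \<open>Any vertex inherits the potential of any other within \<open>d\<close> rounds, at a cost
  of at most \<open>\<rho>\<close> per arc. A connecting walk may have fewer than \<open>d\<close>
  arcs, which \<open>pot_antimono\<close> and \<open>0 \<le> \<rho>\<close> absorb.\<close>

lemma pot_le_hops:
  assumes hop: "\<And>u v. u \<in> pverts G \<Longrightarrow> v \<in> pverts G \<Longrightarrow> \<exists>q. awalk u q v \<and> length q \<le> d"
    and r: "\<And>e. e \<in> parcs G \<Longrightarrow> r e \<le> \<rho>" and "0 \<le> \<rho>" and uv: "u \<in> pverts G" "v \<in> pverts G"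
  shows "pot r p0 (d + t) u \<le> int d * \<rho> + pot r p0 t v"
proof -
  obtain q where q: "awalk u q v" "length q \<le> d"
    using hop[OF uv] by blast
  have "pot r p0 (d + t) u \<le> pot r p0 (length q + t) u"
    using q by (intro pot_antimono) auto
  also have "\<dots> \<le> sum_list (map r q) + pot r p0 t v"
    by (rule pot_awalk_le[OF q(1)])
  also have "sum_list (map r q) \<le> (\<Sum>e\<leftarrow>q. \<rho>)"
    using q(1) by (intro sum_list_mono r) auto
  also have "\<dots> = int (length q) * \<rho>" by (rule sum_list_map_const)
  also have "\<dots> \<le> int d * \<rho>" using q(2) \<open>0 \<le> \<rho>\<close> by (intro mult_right_mono) auto
  finally show ?thesis by simp
qed

lemma cycle_lower_bound:
  assumes c: "cycle c" and mn: "\<And>v. v \<in> pverts G \<Longrightarrow> mn \<le> pot r (\<lambda>_. 0) T v"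
  shows "int (length c) * mn \<le> int T * sum_list (map r c)"
proof -
  obtain u where u: "awalk u c u" using c by (auto simp: cycle_def)
  have "int (length c) * mn = (\<Sum>e\<leftarrow>c. mn)" by (rule sum_list_map_const[symmetric])
  also have "\<dots> \<le> (\<Sum>e\<leftarrow>c. pot r (\<lambda>_. 0) (T + 0) (fst e))"
    using u by (intro sum_list_mono) (auto intro!: mn arc_fst_in_verts)
  also have "\<dots> \<le> int T * sum_list (map r c)"
    using pot_closed_awalk_le[OF u, where r = r and ?p0.0 = "\<lambda>_. 0" and s = T and t = 0] by (simp add: sum_list_map_const)
  finally show ?thesis .
qed

text \<open>An optimal walk is closed by at most \<open>d\<close> further arcs. Relative to
  \<open>\<nu>\<close> a closed walk has nonnegative weight and each closing arc weighs at most
  \<open>2 * W\<close>, so the walk itself cannot fall below \<open>- 2 * d * W\<close>. What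
  remains is the passage from \<open>\<nu>\<close> to \<open>M\<close>.\<close>

lemma pot_ge_of_long_horizon:
  fixes g :: "'a \<times> 'a \<Rightarrow> int" and \<nu> :: real
  assumes hop: "\<And>u v. u \<in> pverts G \<Longrightarrow> v \<in> pverts G \<Longrightarrow> \<exists>q. awalk u q v \<and> length q \<le> d"
    and g: "\<And>e. e \<in> parcs G \<Longrightarrow> \<bar>g e\<bar> \<le> W" and "0 \<le> W"
    and \<nu>: "\<And>c. cycle c \<Longrightarrow> \<nu> * length c \<le> real_of_int (sum_list (map g c))"
    and \<nu>_bounds: "- W \<le> \<nu>" "\<nu> \<le> M" and v: "v \<in> pverts G"
  shows "T * (\<nu> - M) - 2 * real d * W \<le> real_of_int (pot (\<lambda>e. g e - M) (\<lambda>_. 0) T v)"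
proof -
  obtain q u where q: "awalk v q u" "length q \<le> T"
    and p: "pot (\<lambda>e. g e - M) (\<lambda>_. 0) T v = (\<Sum>e\<leftarrow>q. g e - M)"
    using pot_attained[OF v, of T "\<lambda>e. g e - M" "\<lambda>_. 0"] by auto
  have "u \<in> pverts G" using q by auto
  then obtain q' where q': "awalk u q' v" "length q' \<le> d"
    using hop v by blast
  have "0 \<le> (\<Sum>e\<leftarrow>q @ q'. g e - \<nu>)"
  proof (rule closed_awalk_sum_nonneg)
    show "awalk v (q @ q') v" using q q' by (auto intro: awalk_appendI)
    fix c assume "cycle c"
    then show "0 \<le> (\<Sum>e\<leftarrow>c. g e - \<nu>)"
      using \<nu>[of c] by (simp add: sum_list_subtractf sum_list_real_of_int sum_list_triv algebra_simps)
  qed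
  moreover have "(\<Sum>e\<leftarrow>q'. g e - \<nu>) \<le> length q' * (2 * real_of_int W)"
  proof (rule sum_list_map_le)
    fix e assume "e \<in> set q'"
    then have "\<bar>g e\<bar> \<le> W" using q' by (intro g) (auto simp: awalk_def)
    then show "g e - \<nu> \<le> 2 * real_of_int W" using \<nu>_bounds by linarith
  qed
  moreover have "length q' * (2 * real_of_int W) \<le> d * (2 * real_of_int W)"
    using q' \<open>0 \<le> W\<close> by (intro mult_right_mono) auto
  \<comment> \<open>Here \<open>\<nu> \<le> M\<close> enters: a walk with fewer than
    \<open>T\<close> arcs gains no more from the shift than \<open>T\<close> arcs would.\<close>
  moreover have "T * (\<nu> - M) \<le> length q * (\<nu> - M)"
    using q \<nu>_bounds by (intro mult_right_mono_neg) auto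
  moreover have "(\<Sum>e\<leftarrow>q. g e - \<nu>) = (\<Sum>e\<leftarrow>q. real_of_int (g e - M)) - length q * (\<nu> - M)"
    by (simp add: sum_list_subtractf sum_list_triv algebra_simps)
  ultimately show ?thesis
    unfolding p sum_list_real_of_int by simp
qed

end

lemma exists_le_average:
  fixes h :: "'b \<Rightarrow> int"
  assumes "q \<noteq> []"
  shows "\<exists>e\<in>set q. int (length q) * h e \<le> sum_list (map h q)"
proof (rule ccontr)
  assume neg: "\<not> ?thesis"
  obtain e where e: "e \<in> set q" and min: "\<And>e'. e' \<in> set q \<Longrightarrow> h e \<le> h e'"
    using ex_min_if_finite[of "h ` set q"] assms by (force simp: not_less)
  have "int (length q) * h e = (\<Sum>e'\<leftarrow>q. h e)" by (simp add: sum_list_map_const)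
  also have "\<dots> \<le> sum_list (map h q)" by (intro sum_list_mono min)
  finally show False using neg e by auto
qed

context pair_fin_digraph
begin

text \<open>Let \<open>y = d * W\<close>. After \<open>d\<close> rounds every potential is at most
  \<open>2 * T * y\<close>, by a walk to \<open>x\<close>. The next \<open>T - 2 * d\<close> rounds
  go around the cycle \<open>c\<close>, whose arcs weigh at most \<open>2 * y - T\<close> on
  average, and the last \<open>d\<close> rounds carry the gain from some vertex of \<open>c\<close>
  to \<open>x\<close>. In total \<open>x\<close> reaches at most
  \<open>4 * T * y - (T - 2 * y)^2\<close>, which is negative because
  \<open>8 * y \<le> T\<close>.\<close>

lemma pot_less_of_long_horizon:
  fixes g :: "'a \<times> 'a \<Rightarrow> int" and \<nu> :: real
  assumes hop: "\<And>u v. u \<in> pverts G \<Longrightarrow> v \<in> pverts G \<Longrightarrow> \<exists>q. awalk u q v \<and> length q \<le> d"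
    and g: "\<And>e. e \<in> parcs G \<Longrightarrow> \<bar>g e\<bar> \<le> W" and W: "1 \<le> W" and d: "1 \<le> d"
    and c: "cycle c" "real_of_int (sum_list (map g c)) = \<nu> * length c"
    and \<nu>_ge: "- W \<le> \<nu>" and T: "8 * int d * W \<le> int T"
    and M: "T * (\<nu> + 1) - 2 * real d * W \<le> real_of_int M"
    and x: "x \<in> pverts G" and v: "v \<in> pverts G"
  defines "r \<equiv> \<lambda>e. int T * g e - M" and "p0 \<equiv> \<lambda>u. if u = x then 0 else int T * int T"
  shows "pot r p0 T v < p0 v"
proof -
  define y where "y = int d * W"
  have y: "int d \<le> y" "1 \<le> y" "8 * y \<le> int T"
    using W d T mult_left_mono[OF W, of "int d"] mult_mono[of 1 "int d" 1 W] by (auto simp: y_def)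
  have M': "T * (\<nu> + 1) - 2 * real_of_int y \<le> real_of_int M"
    using M by (simp add: y_def)
  \<comment> \<open>Upper bound for a single arc: \<open>T * g e\<close> is at most
    \<open>T * W\<close>, and \<open>M \<ge> - (T * W)\<close> because
    \<open>\<nu> \<ge> - W\<close> and \<open>2 * y \<le> T\<close>.\<close>
  define \<rho> where "\<rho> = 2 * int T * W"
  have "0 \<le> \<rho>" using W by (simp add: \<rho>_def)
  have r: "r e \<le> \<rho>" if "e \<in> parcs G" for e
  proof -
    have "T * g e \<le> T * W" using g[OF that] by (intro mult_left_mono) auto
    moreover have "T * - real_of_int W \<le> T * \<nu>" using \<nu>_ge by (intro mult_left_mono) auto
    then have "- (real T * W) + T - 2 * y \<le> M" using M' by (simp add: algebra_simps)
    then have "real_of_int (- (int T * W) + T - 2 * y) \<le> real_of_int M" by simp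
    then have "- (int T * W) + T - 2 * y \<le> M" by linarith
    moreover have "\<rho> = int T * W + int T * W" by (simp add: \<rho>_def)
    ultimately show ?thesis unfolding r_def using y by linarith
  qed
  \<comment> \<open>The start value \<open>T * T\<close> exceeds the cost of reaching
    \<open>x\<close>, which settles all vertices other than \<open>x\<close>.\<close>
  have yT: "2 * int T * y < int T * int T"
    using y by (simp add: mult.commute)
  have start: "pot r p0 d u \<le> 2 * int T * y" if "u \<in> pverts G" for u
    using pot_le_hops[OF hop r \<open>0 \<le> \<rho>\<close> that x, where ?p0.0 = p0 and t = 0]
    by (simp add: p0_def \<rho>_def y_def algebra_simps)
  show ?thesis
  proof (cases "v = x")
    case False
    have "pot r p0 T v \<le> pot r p0 d v" using y by (intro pot_antimono) auto
    then show ?thesis using False start[OF v] yT by (simp add: p0_def)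
  next
    case True
    define s where "s = T - 2 * d"
    have s: "T = d + (s + d)" "int s = int T - 2 * int d" using y by (auto simp: s_def)
    define X where "X = int T * sum_list (map g c) - int (length c) * M"
    obtain u where u: "awalk u c u" and cne: "c \<noteq> []" using c by (auto simp: cycle_def)
    obtain e where e: "e \<in> set c" and "int (length c) * pot r p0 (s + d) (fst e) \<le> (\<Sum>e\<leftarrow>c. pot r p0 (s + d) (fst e))"
      using exists_le_average[OF cne, of "\<lambda>e. pot r p0 (s + d) (fst e)"] by blast
    note this(2)
    also have "(\<Sum>e\<leftarrow>c. pot r p0 (s + d) (fst e)) \<le> (\<Sum>e\<leftarrow>c. pot r p0 d (fst e)) + int s * sum_list (map r c)"
      by (rule pot_closed_awalk_le[OF u])
    also have "(\<Sum>e\<leftarrow>c. pot r p0 d (fst e)) \<le> (\<Sum>e\<leftarrow>c. 2 * int T * y)"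
      using u by (intro sum_list_mono start) (auto intro: arc_fst_in_verts)
    also have "\<dots> = int (length c) * (2 * int T * y)" by (rule sum_list_map_const)
    also have "sum_list (map r c) = X"
      unfolding r_def X_def by (rule sum_list_affine)
    finally have "real_of_int (int (length c) * pot r p0 (s + d) (fst e))
        \<le> real_of_int (int (length c) * (2 * int T * y) + int s * X)"
      by linarith
    moreover have "real_of_int X = length c * (T * \<nu> - M)"
      using c(2) by (simp add: X_def algebra_simps)
    ultimately have "length c * real_of_int (pot r p0 (s + d) (fst e))
        \<le> length c * (2 * real T * y + s * (T * \<nu> - M))"
      by (simp add: algebra_simps)
    then have "real_of_int (pot r p0 (s + d) (fst e)) \<le> 2 * real T * y + s * (real T * \<nu> - real_of_int M)"
      using cne by simp
    also have "\<dots> \<le> 2 * real T * y + s * (2 * real_of_int y - real T)"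
    proof (intro add_left_mono mult_left_mono)
      show "real T * \<nu> - real_of_int M \<le> 2 * real_of_int y - real T" using M' by (simp add: algebra_simps)
    qed simp
    finally have "real_of_int (pot r p0 (s + d) (fst e)) \<le> real_of_int (2 * int T * y + int s * (2 * y - int T))"
      by simp
    then have "pot r p0 (s + d) (fst e) \<le> 2 * int T * y + int s * (2 * y - int T)"
      by linarith
    moreover have "pot r p0 T x \<le> int d * \<rho> + pot r p0 (s + d) (fst e)"
      unfolding s(1) using u e
      by (intro pot_le_hops[OF hop r \<open>0 \<le> \<rho>\<close> x]) (auto intro: arc_fst_in_verts)
    moreover have "int d * \<rho> = 2 * int T * y" by (simp add: \<rho>_def y_def)
    \<comment> \<open>\<open>s = T - 2 * d\<close> is at least \<open>T - 2 * y\<close>, and the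
      other factor is negative.\<close>
    moreover have "int s * (2 * y - int T) \<le> (int T - 2 * y) * (2 * y - int T)"
      using y s(2) by (intro mult_right_mono_neg) auto
    moreover have "(int T - 2 * y) * (2 * y - int T) = 4 * int T * y - int T * int T - 4 * y * y"
      by (simp add: algebra_simps)
    moreover have "8 * y * int T \<le> int T * int T" "0 < 4 * y * y"
      using y by (auto intro: mult_right_mono)
    moreover have "8 * y * int T = 8 * (int T * y)" "4 * int T * y = 4 * (int T * y)" "2 * int T * y = 2 * (int T * y)" by auto
    ultimately have "pot r p0 T x < 0" by linarith
    then show ?thesis using True by (simp add: p0_def)
  qed
qed

end

section \<open>Symbolic execution\<close>

text \<open>The program stays within the integers and draws nothing at random, so its runs are
  mirrored by a deterministic machine with integer cells. On it, straight-line code can be executed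
  by the simplifier.\<close>

datatype acell = Z int | Nil_cell | W ereal

fun conc :: "acell \<Rightarrow> cell" where
  "conc (Z z) = Num (of_int z)"
| "conc Nil_cell = Null"
| "conc (W x) = Raw x"

record astate =
  reg :: "nat \<Rightarrow> acell option"
  arr :: "nat \<Rightarrow> nat \<Rightarrow> acell option"
  tm :: nat

text \<open>
  The memory consists of 32 registers followed by three arrays, each indexed by \<open>0, \<dots>, n\<close>.
\<close>

definition slot :: "nat \<Rightarrow> nat \<Rightarrow> nat \<Rightarrow> nat" where
  "slot n j i = 32 + j * Suc n + i"

definition lookup :: "nat \<Rightarrow> astate \<Rightarrow> nat \<Rightarrow> acell option" where
  "lookup n a l = (if l < 32 then reg a l
     else if (l - 32) div Suc n < 3 then arr a ((l - 32) div Suc n) ((l - 32) mod Suc n) else None)"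

definition update :: "nat \<Rightarrow> nat \<Rightarrow> acell \<Rightarrow> astate \<Rightarrow> astate" where
  "update n l c a = (if l < 32 then a\<lparr>reg := (reg a)(l \<mapsto> c)\<rparr>
     else a\<lparr>arr := (arr a)((l - 32) div Suc n :=
       (arr a ((l - 32) div Suc n))((l - 32) mod Suc n \<mapsto> c))\<rparr>)"

lemma slot_div_mod: "i \<le> n \<Longrightarrow> (slot n j i - 32) div Suc n = j" "i \<le> n \<Longrightarrow> (slot n j i - 32) mod Suc n = i"
proof -
  assume "i \<le> n"
  moreover have "slot n j i - 32 = i + j * Suc n" by (simp add: slot_def)
  ultimately show "(slot n j i - 32) div Suc n = j" "(slot n j i - 32) mod Suc n = i"
    by (simp_all del: mult_Suc_right)
qed

lemma lookup_reg [simp]: "l < 32 \<Longrightarrow> lookup n a l = reg a l"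
  by (simp add: lookup_def)

lemma lookup_slot [simp]: "i \<le> n \<Longrightarrow> j < 3 \<Longrightarrow> lookup n a (slot n j i) = arr a j i"
  using slot_div_mod[of i n j] by (simp add: lookup_def) (simp add: slot_def)

lemma update_reg [simp]: "l < 32 \<Longrightarrow> update n l c a = a\<lparr>reg := (reg a)(l \<mapsto> c)\<rparr>"
  by (simp add: update_def)

lemma update_slot [simp]:
  "i \<le> n \<Longrightarrow> update n (slot n j i) c a = a\<lparr>arr := (arr a)(j := (arr a j)(i \<mapsto> c))\<rparr>"
  using slot_div_mod[of i n j] by (simp add: update_def) (simp add: slot_def)

definition valid_address :: "nat \<Rightarrow> nat \<Rightarrow> bool" where
  "valid_address n l \<longleftrightarrow> l < 32 + 3 * Suc n"

lemma valid_address_reg [simp]: "l < 32 \<Longrightarrow> valid_address n l"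
  by (simp add: valid_address_def)

lemma valid_address_slot [simp]: "i \<le> n \<Longrightarrow> j < 3 \<Longrightarrow> valid_address n (slot n j i)"
  using mult_right_mono[of j 2 "Suc n"] by (simp add: valid_address_def slot_def)

lemma lookup_update:
  assumes "valid_address n l"
  shows "lookup n (update n l c a) = (lookup n a)(l \<mapsto> c)"
proof
  fix k
  have inj: "k = l" if "\<not> k < 32" "\<not> l < 32" "(k - 32) div Suc n = (l - 32) div Suc n"
    "(k - 32) mod Suc n = (l - 32) mod Suc n"
  proof -
    have "k - 32 = l - 32"
      using that(3,4) by (metis div_mult_mod_eq)
    then show ?thesis using that by simp
  qed
  have "(l - 32) div Suc n < 3" 
    using assms by (subst div_less_iff_less_mult) (auto simp: valid_address_def)
  then show "lookup n (update n l c a) k = ((lookup n a)(l \<mapsto> c)) k"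
    using inj by (auto simp: lookup_def update_def)
qed

text \<open>\<open>bit_length\<close> of an integer: the 2 accounts for the sign and for the
  denominator 1.\<close>

definition int_width :: "int \<Rightarrow> nat" where
  "int_width z = nat (2 + bitlen \<bar>z\<bar>)"

lemma int_width_mono: "\<bar>x\<bar> \<le> z \<Longrightarrow> int_width x \<le> int_width z"
  by (auto simp: int_width_def bitlen_def intro!: nat_mono floorlog_mono)

lemma bit_length_of_int: "bit_length (of_int z) = int_width z"
  by (simp add: bit_length_def int_width_def bitlen_alt_def[of 1])

section \<open>The abstract machine and its simulation\<close>

locale machine =
  fixes n :: nat and eo :: edge_oracle and wo :: weight_oracle and bound :: int
begin

text \<open>Time and memory agree exactly, so the cell count can be read off from the addresses that
  \<open>lookup\<close> accepts; the width is only bounded, by that of \<open>bound\<close>.\<close>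

definition models :: "state \<Rightarrow> astate \<Rightarrow> bool" where
  "models s a \<longleftrightarrow> mem s = (\<lambda>l. map_option conc (lookup n a l)) \<and> steps s = tm a \<and> width s \<le> int_width bound"

fun small :: "acell \<Rightarrow> bool" where
  "small (Z z) \<longleftrightarrow> \<bar>z\<bar> \<le> bound"
| "small _ \<longleftrightarrow> True"

text \<open>A write fails outside the registers and arrays, and also for a number larger than
  \<open>bound\<close>. A symbolic execution that does not fail therefore proves the memory and
  width bounds along the way.\<close>

definition aput :: "nat \<Rightarrow> acell \<Rightarrow> astate \<Rightarrow> astate option" where
  "aput l c a = (if valid_address n l \<and> small c then Some (update n l c a) else None)"

definition aint :: "astate \<Rightarrow> nat \<Rightarrow> int option" where
  "aint a l = (case lookup n a l of Some (Z z) \<Rightarrow> Some z | _ \<Rightarrow> None)"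

definition anat :: "astate \<Rightarrow> nat \<Rightarrow> nat option" where
  "anat a l = (case aint a l of Some z \<Rightarrow> if z \<ge> 0 then Some (nat z) else None | None \<Rightarrow> None)"

definition araw :: "astate \<Rightarrow> nat \<Rightarrow> real option" where
  "araw a l = (case lookup n a l of Some (W (ereal x)) \<Rightarrow> Some x | _ \<Rightarrow> None)"

fun astep :: "instr \<Rightarrow> astate \<Rightarrow> astate option" where
  "astep (Const l z) a = aput l (Z z) a"
| "astep (Move l k) a = do { c \<leftarrow> lookup n a k; aput l c a }"
| "astep (Load l k) a = do { i \<leftarrow> anat a k; c \<leftarrow> lookup n a i; aput l c a }"
| "astep (Store l k) a = do { i \<leftarrow> anat a l; c \<leftarrow> lookup n a k; aput i c a }"
| "astep (Arith Add l i j) a = do { x \<leftarrow> aint a i; y \<leftarrow> aint a j; aput l (Z (x + y)) a }"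
| "astep (Arith Sub l i j) a = do { x \<leftarrow> aint a i; y \<leftarrow> aint a j; aput l (Z (x - y)) a }"
| "astep (Arith Mul l i j) a = do { x \<leftarrow> aint a i; y \<leftarrow> aint a j; aput l (Z (x * y)) a }"
| "astep (Discretise l k b u) a = do {
     q \<leftarrow> aint a k; x \<leftarrow> araw a b; y \<leftarrow> araw a u;
     if y = 0 then None else aput l (Z \<lfloor>of_int q * x / y\<rfloor>) a }"
| "astep (Query_Edge l k i j) a = do {
     v \<leftarrow> anat a i; e \<leftarrow> anat a j;
     b \<leftarrow> aput l (case fst (eo v e) of None \<Rightarrow> Nil_cell | Some e \<Rightarrow> Z (int (fst e))) a;
     aput k (case snd (eo v e) of None \<Rightarrow> Nil_cell | Some e \<Rightarrow> Z (int (snd e))) b }"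
| "astep (Query_Weight l i j) a = do {
     u \<leftarrow> anat a i; v \<leftarrow> anat a j; aput l (W (wo u v)) a }"
| "astep _ a = None"

fun atest :: "test \<Rightarrow> astate \<Rightarrow> bool option" where
  "atest (Less i j) a = do { x \<leftarrow> aint a i; y \<leftarrow> aint a j; Some (x < y) }"
| "atest (Is_Null i) a = map_option (\<lambda>c. c = Nil_cell) (lookup n a i)"
| "atest (Is_Inf i) a = None"

definition atick :: "astate \<Rightarrow> astate" where
  "atick a = a\<lparr>tm := Suc (tm a)\<rparr>"

lemma atick_simps [simp]:
  "reg (atick a) = reg a" "arr (atick a) = arr a" "tm (atick a) = Suc (tm a)"
  by (simp_all add: atick_def)

lemma lookup_atick [simp]: "lookup n (atick a) = lookup n a"
  by (rule ext) (simp add: lookup_def atick_def)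

lemma models_tick: "models s a \<Longrightarrow> models (tick s) (atick a)"
  by (auto simp: models_def tick_def)

lemma models_get_num: "models s a \<Longrightarrow> aint a l = Some z \<Longrightarrow> get_num s l = Some (of_int z)"
  by (auto simp: models_def aint_def get_num_def split: option.splits acell.splits)

lemma models_get_nat:
  assumes "models s a" "anat a l = Some i"
  shows "get_nat s l = Some i"
proof -
  obtain z where z: "aint a l = Some z" "z \<ge> 0" "i = nat z"
    using assms(2) by (auto simp: anat_def split: option.splits if_splits)
  then have "(of_int z :: rat) \<in> \<nat>" by (metis of_int_of_nat_eq of_nat_in_Nats int_nat_eq)
  then show ?thesis using models_get_num[OF assms(1) z(1)] z(3) by (simp add: get_nat_def)
qed

lemma models_get_raw: "models s a \<Longrightarrow> araw a l = Some x \<Longrightarrow> get_raw s l = Some x"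
  by (auto simp: models_def araw_def get_raw_def split: option.splits acell.splits ereal.splits)

lemma models_mem: "models s a \<Longrightarrow> lookup n a l = Some c \<Longrightarrow> mem s l = Some (conc c)"
  by (auto simp: models_def)

lemma models_put:
  assumes "models s a" "aput l c a = Some a'"
  shows "models (put l (conc c) s) a'"
proof -
  have *: "valid_address n l" "small c" "a' = update n l c a"
    using assms(2) by (auto simp: aput_def split: if_splits)
  have "cell_width (conc c) \<le> int_width bound"
    using *(2) by (cases c) (auto simp: bit_length_of_int int_width_mono)
  then show ?thesis
    using assms(1) * by (auto simp: models_def put_def lookup_update fun_eq_iff) (simp add: update_def)
qed

lemma astep_correct:
  assumes "models s a" "astep i a = Some a'"
  shows "\<exists>s'. exec_instr eo wo i s = return_spmf s' \<and> models s' a'"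
proof (cases i)
  case (Query_Edge l k i j)
  then obtain v e b where *: "anat a i = Some v" "anat a j = Some e"
    "aput l (case fst (eo v e) of None \<Rightarrow> Nil_cell | Some e \<Rightarrow> Z (int (fst e))) a = Some b"
    "aput k (case snd (eo v e) of None \<Rightarrow> Nil_cell | Some e \<Rightarrow> Z (int (snd e))) b = Some a'"
    using assms(2) by (auto simp: bind_eq_Some_conv)
  have "models (put k (conc (case snd (eo v e) of None \<Rightarrow> Nil_cell | Some e \<Rightarrow> Z (int (snd e))))
      (put l (conc (case fst (eo v e) of None \<Rightarrow> Nil_cell | Some e \<Rightarrow> Z (int (fst e)))) s)) a'"
    by (rule models_put[OF models_put[OF assms(1) *(3)] *(4)])
  then show ?thesis
    using models_get_nat[OF assms(1) *(1)] models_get_nat[OF assms(1) *(2)] Query_Edge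
    by (auto simp: exec_instr_def Let_def split: option.splits)
next
  case (Discretise l k b u)
  then obtain q x y where "aint a k = Some q" "araw a b = Some x" "araw a u = Some y" "y \<noteq> 0"
    "aput l (Z \<lfloor>of_int q * x / y\<rfloor>) a = Some a'"
    using assms(2) by (auto simp: bind_eq_Some_conv split: if_splits)
  then show ?thesis
    using Discretise models_get_num[OF assms(1), of k] models_get_raw[OF assms(1), of b]
      models_get_raw[OF assms(1), of u] models_put[OF assms(1)]
    by (force simp: exec_instr_def)
next
  case (Arith f l i j)
  then show ?thesis
    using assms(2) by (cases f) (auto simp: exec_instr_def bind_eq_Some_conv
        dest!: models_get_num[OF assms(1)] models_put[OF assms(1)])
qed (use assms(2) in \<open>auto simp: exec_instr_def bind_eq_Some_conv split: if_splits
      dest!: models_get_num[OF assms(1)] models_get_nat[OF assms(1)] models_get_raw[OF assms(1)]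
        models_mem[OF assms(1)] models_put[OF assms(1)]\<close>)

lemma atest_correct: "models s a \<Longrightarrow> atest b a = Some t \<Longrightarrow> eval_test b s = Some t"
proof (cases b)
  case (Is_Null i)
  assume "models s a" "atest b a = Some t"
  moreover have "(conc c = Null) = (c = Nil_cell)" for c by (cases c) auto
  ultimately show ?thesis using Is_Null by (auto simp: models_mem)
next
  case (Less i j)
  assume s: "models s a" and "atest b a = Some t"
  then show ?thesis using Less
    by (auto simp: bind_eq_Some_conv dest!: models_get_num[OF s])
qed auto

text \<open>Total correctness with a point mass as outcome. Resources need no rules of their own:
  \<open>\<Phi>\<close> can speak of \<open>tm\<close>, and \<open>models\<close> carries memory and
  width.\<close>

definition runs :: "com \<Rightarrow> astate \<Rightarrow> (astate \<Rightarrow> bool) \<Rightarrow> bool" where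
  "runs c a \<Phi> \<longleftrightarrow> (\<forall>s. models s a \<longrightarrow>
     (\<exists>s' a'. exec eo wo c s = return_spmf s' \<and> models s' a' \<and> \<Phi> a'))"

section \<open>Proof rules for commands and loops\<close>

lemma runs_mono: "runs c a \<Phi> \<Longrightarrow> (\<And>b. \<Phi> b \<Longrightarrow> \<Psi> b) \<Longrightarrow> runs c a \<Psi>"
  unfolding runs_def by blast

lemma runs_Skip: "\<Phi> a \<Longrightarrow> runs Skip a \<Phi>"
  by (auto simp: runs_def)

lemma runs_Do: "astep i (atick a) = Some b \<Longrightarrow> \<Phi> b \<Longrightarrow> runs (Do i) a \<Phi>"
  unfolding runs_def using astep_correct models_tick by fastforce

lemma runs_Seq: "runs c a (\<lambda>b. runs d b \<Phi>) \<Longrightarrow> runs (Seq c d) a \<Phi>"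
  unfolding runs_def by fastforce

lemma runs_If:
  "atest t a = Some True \<Longrightarrow> runs c (atick a) \<Phi> \<Longrightarrow> runs (If t c d) a \<Phi>"
  "atest t a = Some False \<Longrightarrow> runs d (atick a) \<Phi> \<Longrightarrow> runs (If t c d) a \<Phi>"
  unfolding runs_def using atest_correct models_tick by fastforce+

lemma runs_While_False: "atest t a = Some False \<Longrightarrow> \<Phi> (atick a) \<Longrightarrow> runs (While t c) a \<Phi>"
  unfolding runs_def
proof (intro allI impI)
  fix s assume t: "atest t a = Some False" and "\<Phi> (atick a)" and s: "models s a"
  then show "\<exists>s' a'. exec eo wo (While t c) s = return_spmf s' \<and> models s' a' \<and> \<Phi> a'"
    using atest_correct[OF s t] models_tick[OF s] by (auto simp: while_loop.simps[of _ _ s])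
qed

lemma runs_While_True:
  assumes "atest t a = Some True" "runs c (atick a) (\<lambda>b. runs (While t c) b \<Phi>)"
  shows "runs (While t c) a \<Phi>"
  unfolding runs_def
proof (intro allI impI)
  fix s assume s: "models s a"
  obtain s' b where "exec eo wo c (tick s) = return_spmf s'" "models s' b" "runs (While t c) b \<Phi>"
    using assms(2) models_tick[OF s] unfolding runs_def[of c] by blast
  then show "\<exists>s' a'. exec eo wo (While t c) s = return_spmf s' \<and> models s' a' \<and> \<Phi> a'"
    using atest_correct[OF s assms(1)] unfolding runs_def
    by (auto simp: while_loop.simps[of _ _ s])
qed

lemma runs_While:
  fixes meas :: "astate \<Rightarrow> nat"
  assumes "I a"
    and "\<And>a. I a \<Longrightarrow> (atest t a = Some True \<and> runs c (atick a) (\<lambda>b. I b \<and> meas b < meas a))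
      \<or> (atest t a = Some False \<and> \<Phi> (atick a))"
  shows "runs (While t c) a \<Phi>"
  using assms(1)
proof (induction "meas a" arbitrary: a rule: less_induct)
  case less
  then have *: "runs (While t c) b \<Phi>" if "I b \<and> meas b < meas a" for b
    using that by blast
  show ?case
    using assms(2)[OF less.prems]
      runs_While_True[of t a c, OF _ runs_mono[OF _ *]] runs_While_False[of t a \<Phi> c] by blast
qed

text \<open>The index \<open>i\<close> is a ghost variable, tied to the counter of the machine only
  by \<open>I\<close>; this leaves room for a counter that jumps, as in
  \<open>scan_arcs\<close>.\<close>

lemma runs_for:
  assumes "I lo a" "lo \<le> hi"
    and "\<And>i a. lo \<le> i \<Longrightarrow> i < hi \<Longrightarrow> I i a \<Longrightarrow> atest t a = Some True \<and> runs c (atick a) (I (Suc i))"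
    and "\<And>a. I hi a \<Longrightarrow> atest t a = Some False \<and> \<Phi> (atick a)"
  shows "runs (While t c) a \<Phi>"
  using assms(2,1)
proof (induction lo arbitrary: a rule: inc_induct)
  case base
  then show ?case using assms(4) by (auto intro: runs_While_False)
next
  case (step i)
  then show ?case
    using runs_While_True[OF _ runs_mono[where \<Psi> = "\<lambda>b. runs (While t c) b \<Phi>"]] assms(3)[of i a]
    by blast
qed

end

section \<open>The program\<close>

primrec block :: "instr list \<Rightarrow> com" where
  "block [] = Skip"
| "block (i # is) = Seq (Do i) (block is)"

text \<open>
  The registers \<open>rP\<close>, \<open>rQ\<close>, \<open>rF\<close> hold the base addresses of the arrays of old potentials, new
  potentials (later reused for the output) and successor pointers.
\<close>

abbreviation (input) "rN \<equiv> 0 :: nat"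
abbreviation (input) "rEps \<equiv> 1 :: nat"
abbreviation (input) "rZero \<equiv> 2 :: nat"
abbreviation (input) "rOne \<equiv> 3 :: nat"
abbreviation (input) "rTwo \<equiv> 4 :: nat"
abbreviation (input) "rP \<equiv> 5 :: nat"
abbreviation (input) "rQ \<equiv> 6 :: nat"
abbreviation (input) "rF \<equiv> 7 :: nat"
abbreviation (input) "rLen \<equiv> 8 :: nat"
abbreviation (input) "rT \<equiv> 9 :: nat"
abbreviation (input) "rS \<equiv> 10 :: nat"
abbreviation (input) "rM \<equiv> 11 :: nat"
abbreviation (input) "rB \<equiv> 12 :: nat"
abbreviation (input) "rt \<equiv> 13 :: nat"
abbreviation (input) "rv \<equiv> 14 :: nat"
abbreviation (input) "rk \<equiv> 15 :: nat"
abbreviation (input) "ru \<equiv> 16 :: nat"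
abbreviation (input) "rtmp \<equiv> 17 :: nat"
abbreviation (input) "rraw \<equiv> 18 :: nat"
abbreviation (input) "rcand \<equiv> 19 :: nat"
abbreviation (input) "rbest \<equiv> 20 :: nat"
abbreviation (input) "rmin \<equiv> 21 :: nat"
abbreviation (input) "rx \<equiv> 22 :: nat"
abbreviation (input) "rjunk \<equiv> 23 :: nat"
abbreviation (input) "ri \<equiv> 24 :: nat"

text \<open>The weight is queried and discretised anew at every visit, since storing
  \<open>m\<close> of them would exceed linear memory. The candidate is \<open>S * g - M\<close>
  plus the old potential of \<open>ru\<close>; both runs share the code through \<open>rS\<close>
  and \<open>rM\<close>.\<close>

definition relax_arc :: com where
  "relax_arc = Seq
     (block [Query_Weight rraw rv ru, Discretise rcand rTwo rraw rEps, Arith Mul rcand rS rcand,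
        Arith Sub rcand rcand rM, Arith Add rtmp rP ru, Load rtmp rtmp, Arith Add rcand rcand rtmp])
     (If (Less rcand rbest) (block [Move rbest rcand, Arith Add rtmp rF rv, Store rtmp ru]) Skip)"

text \<open>Setting the counter to \<open>n + 1\<close> leaves the loop at the first null arc.\<close>

definition scan_arcs :: com where
  "scan_arcs = While (Less rk rLen) (Seq (block [Query_Edge rjunk ru rv rk])
     (If (Is_Null ru) (block [Move rk rLen]) (Seq relax_arc (block [Arith Add rk rk rOne]))))"

definition relax_vertex :: com where
  "relax_vertex = Seq (block [Arith Add rtmp rP rv, Load rbest rtmp, Const rk 1]) (Seq scan_arcs
     (block [Arith Add rtmp rQ rv, Store rtmp rbest, Arith Add rv rv rOne]))"

text \<open>Old and new potentials are kept apart until the round is over, so that a round computes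
  exactly \<open>relax\<close>. The minimum is not reset between rounds, which is harmless because
  potentials only decrease.\<close>

definition copy_vertex :: com where
  "copy_vertex = Seq
     (block [Arith Add rtmp rQ rv, Load rcand rtmp, Arith Add rtmp rP rv, Store rtmp rcand])
     (Seq (If (Less rcand rmin) (block [Move rmin rcand]) Skip) (block [Arith Add rv rv rOne]))"

definition round :: com where
  "round = Seq (block [Const rv 1]) (Seq (While (Less rv rLen) relax_vertex)
     (Seq (block [Const rv 1]) (Seq (While (Less rv rLen) copy_vertex) (block [Arith Add rt rt rOne]))))"

text \<open>Vertex 1 starts at 0, all others at \<open>rB\<close>. The filling loop begins at index
  0, which makes 0 its own pointer and hence a sink for \<open>follow\<close>.\<close>

definition bellman_ford :: com where
  "bellman_ford = Seq (block [Const rmin 0, Const rv 0])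
     (Seq (While (Less rv rLen) (block [Arith Add rtmp rP rv, Store rtmp rB,
        Arith Add rtmp rF rv, Store rtmp rZero, Arith Add rv rv rOne]))
     (Seq (block [Arith Add rtmp rP rOne, Store rtmp rZero, Const rt 0])
       (While (Less rt rT) round)))"

text \<open>After \<open>n\<close> pointers the walk from vertex 1 either has been absorbed by 0 or,
  by counting vertices, stands on a cycle of pointers.\<close>

definition follow :: com where
  "follow = Seq (block [Const rx 1, Const ri 0])
     (While (Less ri rN) (block [Arith Add rtmp rF rx, Load rx rtmp, Arith Add ri ri rOne]))"

text \<open>The second run has \<open>M = T * T + rmin + T\<close>, the new zero multiplied by
  \<open>T\<close>. Its start value \<open>T * T\<close> is large enough that, on a long horizon, a
  walk of \<open>d\<close> arcs to vertex 1 is always cheaper.\<close>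

definition attempt :: com where
  "attempt = Seq (block [Arith Add rT rT rT, Const rS 1, Move rM rT, Const rB 0]) (Seq bellman_ford
     (Seq (block [Arith Mul rB rT rT, Arith Add rM rB rmin, Arith Add rM rM rT, Move rS rT])
     (Seq bellman_ford follow)))"

text \<open>Pointers are erased as they are followed, so the loop ends when the cycle closes.\<close>

definition output_cycle :: com where
  "output_cycle = Seq (block [Const ri 0, Arith Add rtmp rF rx, Load ru rtmp])
     (Seq (While (Less rZero ru) (block [Arith Add rtmp rQ ri, Store rtmp rx,
        Arith Add rtmp rF rx, Store rtmp rZero, Move rx ru, Arith Add rtmp rF rx, Load ru rtmp,
        Arith Add ri ri rOne]))
     (block [Move rN ri, Move rEps rQ]))"

text \<open>\<open>rx = 0\<close> stands for no cycle found so far; \<open>rT\<close> starts at 1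
  because \<open>attempt\<close> doubles it before use.\<close>

definition program :: com where
  "program = Seq (block [Const rZero 0, Const rOne 1, Const rTwo 2, Const rP 32,
        Arith Add rLen rN rOne, Arith Add rQ rP rLen, Arith Add rF rQ rLen, Const rT 1, Const rx 0])
     (Seq (While (Less rx rOne) attempt) output_cycle)"

context machine
begin

primrec ablock :: "instr list \<Rightarrow> astate \<Rightarrow> astate option" where
  "ablock [] a = Some a"
| "ablock (i # is) a = Option.bind (astep i (atick a)) (ablock is)"

lemma runs_block: "ablock is a = Some b \<Longrightarrow> \<Phi> b \<Longrightarrow> runs (block is) a \<Phi>"
  by (induction "is" arbitrary: a) (auto simp: bind_eq_Some_conv intro!: runs_Skip runs_Seq runs_Do)

lemma slot_add [simp]:
  "int (slot n j 0) + int i = int (slot n j i)"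
  "int (slot n j 0) + 1 = int (slot n j (Suc 0))"
  by (simp_all add: slot_def)

end

section \<open>Verification of the program\<close>

text \<open>Addresses are computed by the machine's own arithmetic, so they too must obey the size
  limit; this is \<open>bound_slot\<close>.\<close>

locale rounding = pair_fin_digraph G + machine n eo "weight_oracle_of G w" bound
  for G :: "nat pair_pre_digraph" and n :: nat and eo :: edge_oracle
    and w :: "nat \<times> nat \<Rightarrow> real" and bound :: int +
  fixes \<epsilon> :: real
  assumes verts: "pverts G = {1..n}" and n_pos: "1 \<le> n" and edge_oracle: "is_edge_oracle G eo"
    and eps: "0 < \<epsilon>" and bound_slot: "int (slot n 3 0) \<le> bound"
begin

definition g :: "nat \<times> nat \<Rightarrow> int" where
  "g e = \<lfloor>2 * w e / \<epsilon>\<rfloor>"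

abbreviation deg :: "nat \<Rightarrow> nat" where
  "deg v \<equiv> out_degree (with_proj G) v"

definition succ :: "nat \<Rightarrow> nat \<Rightarrow> nat" where
  "succ v k = snd (the (snd (eo v k)))"

lemma arc_verts: "(v, u) \<in> parcs G \<Longrightarrow> v \<in> {1..n} \<and> u \<in> {1..n}"
  using verts in_arcsD1 in_arcsD2 by blast

lemma card_verts: "card (pverts G) = n"
  by (simp add: verts)

lemma oracle_arc:
  assumes "v \<in> {1..n}" "k \<in> {1..deg v}"
  shows "snd (eo v k) = Some (v, succ v k)" "(v, succ v k) \<in> parcs G"
proof -
  have "snd (eo v k) \<in> Some ` out_arcs (with_proj G) v"
    using edge_oracle assms verts unfolding is_edge_oracle_def bij_betw_def by blast
  then show "snd (eo v k) = Some (v, succ v k)" "(v, succ v k) \<in> parcs G"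
    by (auto simp: succ_def out_arcs_def)
qed

lemma oracle_surj:
  assumes "(v, u) \<in> parcs G"
  shows "\<exists>k\<in>{1..deg v}. succ v k = u"
proof -
  have "Some (v, u) \<in> Some ` out_arcs (with_proj G) v"
    using assms by (auto simp: out_arcs_def)
  moreover have "v \<in> pverts G" using assms by (auto dest: in_arcsD1)
  ultimately have "Some (v, u) \<in> (\<lambda>k. snd (eo v k)) ` {1..deg v}"
    using edge_oracle unfolding is_edge_oracle_def bij_betw_def by blast
  then obtain k where "k \<in> {1..deg v}" "Some (v, u) = snd (eo v k)" by blast
  then show ?thesis by (intro bexI[of _ k]) (auto simp: succ_def dest: sym)
qed

lemma oracle_None:
  assumes "v \<in> {1..n}" "deg v < k" "k \<le> n"
  shows "snd (eo v k) = None"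
  using edge_oracle assms verts card_verts unfolding is_edge_oracle_def by auto

text \<open>The program follows outgoing arcs, but \<open>Query_Edge\<close> also writes the tail of
  the incoming one, and this number must fit into \<open>bound\<close> as well.\<close>

lemma oracle_in:
  assumes "v \<in> {1..n}" "k \<in> {1..n}" "fst (eo v k) = Some e"
  shows "fst e \<in> {1..n}"
proof -
  have "k \<le> in_degree (with_proj G) v"
    using edge_oracle assms verts card_verts unfolding is_edge_oracle_def by (metis (no_types, lifting)
        atLeastAtMost_iff greaterThanAtMost_iff not_le_imp_less option.distinct(1))
  then have "fst (eo v k) \<in> Some ` in_arcs (with_proj G) v"
    using edge_oracle assms verts unfolding is_edge_oracle_def bij_betw_def by (metis atLeastAtMost_iff image_eqI)
  then show ?thesis using assms(3) arc_verts by (auto simp: in_arcs_def)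
qed

lemma deg_le: "deg v \<le> n"
proof -
  have "out_arcs (with_proj G) v \<subseteq> Pair v ` {1..n}"
    using arc_verts by (force simp: out_arcs_def)
  then have "card (out_arcs (with_proj G) v) \<le> card (Pair v ` {1..n})"
    by (intro card_mono) auto
  also have "\<dots> \<le> n" using card_image_le[of "{1..n}" "Pair v"] by simp
  finally show ?thesis by (simp add: out_degree_def)
qed

lemma sum_deg: "(\<Sum>v\<in>{1..n}. deg v) = card (parcs G)"
proof -
  have "parcs G = (\<Union>v\<in>{1..n}. out_arcs (with_proj G) v)"
    using arc_verts by (fastforce simp: out_arcs_def)
  also have "card \<dots> = (\<Sum>v\<in>{1..n}. card (out_arcs (with_proj G) v))"
    by (intro card_UN_disjoint) (auto simp: out_arcs_def intro: finite_subset[OF _ pair_finite_arcs])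
  finally show ?thesis by (simp add: out_degree_def)
qed

lemma bound_slot' [simp]: "i \<le> n \<Longrightarrow> j < 3 \<Longrightarrow> int (slot n j i) \<le> bound"
  using bound_slot mult_right_mono[of j 2 "Suc n"] by (simp add: slot_def algebra_simps flip: of_nat_add of_nat_mult)

lemma bound_ge [simp]: "i \<le> Suc n \<Longrightarrow> int i \<le> bound" "0 \<le> bound" "1 \<le> bound" "2 \<le> bound" "32 \<le> bound"
  using bound_slot by (simp_all add: slot_def)

definition base :: "astate \<Rightarrow> bool" where
  "base a \<longleftrightarrow> reg a rN = Some (Z (int n)) \<and> reg a rEps = Some (W (ereal \<epsilon>)) \<and>
     reg a rZero = Some (Z 0) \<and> reg a rOne = Some (Z 1) \<and> reg a rTwo = Some (Z 2) \<and>
     reg a rP = Some (Z (int (slot n 0 0))) \<and> reg a rQ = Some (Z (int (slot n 1 0))) \<and>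
     reg a rF = Some (Z (int (slot n 2 0))) \<and> reg a rLen = Some (Z (int n + 1))"

definition params :: "nat \<Rightarrow> int \<Rightarrow> int \<Rightarrow> int \<Rightarrow> astate \<Rightarrow> bool" where
  "params T S M B a \<longleftrightarrow> reg a rT = Some (Z (int T)) \<and> reg a rS = Some (Z S) \<and>
     reg a rM = Some (Z M) \<and> reg a rB = Some (Z B)"

definition holds :: "astate \<Rightarrow> nat \<Rightarrow> nat set \<Rightarrow> (nat \<Rightarrow> int) \<Rightarrow> bool" where
  "holds a j I q \<longleftrightarrow> (\<forall>i\<in>I. arr a j i = Some (Z (q i)))"

lemmas exec_simps = aint_def anat_def araw_def aput_def atick_def

end

text \<open>The conditions cover each intermediate value of \<open>relax_arc\<close>:
  \<open>g\<close>, then \<open>S * g\<close>, then \<open>S * g - M\<close>, then the candidate. A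
  candidate may exceed a potential by \<open>R\<close>, hence \<open>T + 1\<close> instead of
  \<open>T\<close> in \<open>B_le\<close>.\<close>

locale bf_run = rounding +
  fixes T :: nat and S M B R :: int
  assumes T_le: "int T \<le> bound" and S_g_le: "e \<in> parcs G \<Longrightarrow> \<bar>S * g e\<bar> \<le> bound"
    and g_le: "e \<in> parcs G \<Longrightarrow> \<bar>g e\<bar> \<le> bound"
    and R: "e \<in> parcs G \<Longrightarrow> \<bar>S * g e - M\<bar> \<le> R" "0 \<le> R"
    and B_le: "\<bar>B\<bar> + int (T + 1) * R \<le> bound" and n_le: "n \<le> card (parcs G)"
begin

abbreviation r :: "nat \<times> nat \<Rightarrow> int" where
  "r e \<equiv> S * g e - M"

definition p0 :: "nat \<Rightarrow> int" where
  "p0 v = (if v = 1 then 0 else B)"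

abbreviation pt :: "nat \<Rightarrow> nat \<Rightarrow> int" where
  "pt t \<equiv> pot r p0 t"

text \<open>
  \<open>q\<close> is the potential under construction and \<open>p\<close> the one of the previous round; the
  successor pointers \<open>f\<close> (0 standing for none) record why an entry has decreased.
\<close>

definition tight :: "(nat \<Rightarrow> int) \<Rightarrow> (nat \<Rightarrow> int) \<Rightarrow> (nat \<Rightarrow> nat) \<Rightarrow> bool" where
  "tight p q f \<longleftrightarrow> f 0 = 0 \<and> (\<forall>v\<in>{1..n}. (f v = 0 \<and> q v = p0 v) \<or>
     ((v, f v) \<in> parcs G \<and> r (v, f v) + p (f v) \<le> q v))"

text \<open>\<open>I\<close> is the part of array 1 already written in the current round, so that
  one predicate serves the relaxation pass, the copy pass and the points between rounds.\<close>

definition snap :: "nat \<Rightarrow> nat \<Rightarrow> int \<Rightarrow> (nat \<Rightarrow> int) \<Rightarrow> nat set \<Rightarrow> (nat \<Rightarrow> int) \<Rightarrow> (nat \<Rightarrow> nat) \<Rightarrow> astate \<Rightarrow> bool" where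
  "snap t v mn q I q' f a \<longleftrightarrow> base a \<and> params T S M B a \<and> reg a rt = Some (Z (int t)) \<and>
     reg a rv = Some (Z (int v)) \<and> reg a rmin = Some (Z mn) \<and> holds a 0 {..n} q \<and>
     holds a 1 I q' \<and> holds a 2 {..n} (int \<circ> f)"

lemma R_le: "R \<le> bound"
  using B_le R(2) by (simp add: algebra_simps) (smt (verit) mult_nonneg_nonneg of_nat_0_le_iff)

lemma runs_relax_arc:
  assumes a: "snap t v mn q I q' f a" "reg a rk = Some (Z (int k))" "reg a ru = Some (Z (int u))" "reg a rbest = Some (Z b)"
    and vu: "(v, u) \<in> parcs G" and q: "\<And>i. i \<in> {1..n} \<Longrightarrow> \<bar>q i\<bar> \<le> bound" "\<bar>r (v, u) + q u\<bar> \<le> bound" "\<bar>b\<bar> \<le> bound"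
  defines "c \<equiv> r (v, u) + q u"
  shows "runs relax_arc a (\<lambda>a'. snap t v mn q I q' (if c < b then f(v := u) else f) a' \<and> reg a' rk = Some (Z (int k)) \<and>
    reg a' rbest = Some (Z (min b c)) \<and> tm a' \<le> tm a + 11)"
proof -
  have uv: "v \<le> n" "u \<le> n" "u \<in> {1..n}" using arc_verts[OF vu] by auto
  have f: "\<lfloor>2 * w (v, u) / \<epsilon>\<rfloor> = g (v, u)" by (simp add: g_def)
  note bs = g_le[OF vu] S_g_le[OF vu] R(1)[OF vu] q(1)[OF uv(3)]
  note simps = exec_simps snap_def base_def params_def holds_def weight_oracle_of_def f c_def
  note facts = a uv bs R_le vu eps q
  show ?thesis
    unfolding relax_arc_def
    apply (rule runs_Seq, rule runs_block)
     apply (use facts in \<open>simp add: simps\<close>)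
    apply (cases "c < b")
     apply (rule runs_If(1))
      apply (use facts in \<open>simp add: simps\<close>)
     apply (rule runs_block)
      apply (use facts in \<open>simp add: simps\<close>)
     apply (use facts in \<open>simp add: simps\<close>)
    apply (rule runs_If(2))
     apply (use facts in \<open>simp add: simps\<close>)
    apply (rule runs_Skip)
    apply (use facts in \<open>simp add: simps\<close>)
    done
qed

lemma snap_atick [simp]: "snap t v mn q I q' f (atick a) = snap t v mn q I q' f a"
  by (simp add: snap_def base_def params_def holds_def)

lemma runs_scan_arcs:
  assumes a: "snap t v mn q I q' f a" "reg a rk = Some (Z 1)" "reg a rbest = Some (Z (q v))"
    and v: "v \<in> {1..n}" and q: "\<And>i. i \<in> {1..n} \<Longrightarrow> \<bar>q i\<bar> + R \<le> bound"
    and tight: "tight q h f" "h v = q v"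
  shows "runs scan_arcs a (\<lambda>a'. \<exists>f'. snap t v mn q I q' f' a' \<and> reg a' rbest = Some (Z (relax r q v)) \<and>
    tight q (h(v := relax r q v)) f' \<and> tm a' \<le> tm a + 20 * deg v + 10)"
proof -
  \<comment> \<open>Up to the first null arc the index \<open>k\<close> is the counter; the null arc
    moves the counter to \<open>n + 1\<close>, for which the index \<open>deg v + 2\<close> stands.
    Besides being a lower bound on the candidates seen, \<open>b\<close> is attained, so that
    \<open>relax_eqI\<close> identifies it at the end.\<close>
  define inv where "inv k a' \<longleftrightarrow> (\<exists>f' b. snap t v mn q I q' f' a' \<and>
      reg a' rk = Some (Z (int (if k \<le> deg v + 1 then k else Suc n))) \<and> reg a' rbest = Some (Z b) \<and>
      tight q (h(v := b)) f' \<and> b \<le> q v \<and>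
      (\<forall>j\<in>{1..<k}. j \<le> deg v \<longrightarrow> b \<le> r (v, succ v j) + q (succ v j)) \<and>
      (b = q v \<or> (\<exists>u. (v, u) \<in> parcs G \<and> b = r (v, u) + q u)) \<and>
      tm a' \<le> tm a + 20 * min (k - 1) (deg v) + (if k \<le> deg v + 1 then 0 else 5))" for k a'
  have q_bound: "\<bar>q i\<bar> \<le> bound" if "i \<in> {1..n}" for i
    using q[OF that] R(2) by linarith
  have arc_bound: "\<bar>r (v, u) + q u\<bar> \<le> bound" if "(v, u) \<in> parcs G" for u
    using q[of u] R(1)[OF that] arc_verts[OF that] by (auto simp: abs_le_iff)
  \<comment> \<open>With fewer than \<open>n\<close> arcs the loop has one more iteration, which
    meets a null arc; with \<open>n\<close> arcs the counter runs out by itself.\<close>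
  define hi where "hi = (if deg v < n then deg v + 2 else deg v + 1)"
  note simps = exec_simps snap_def base_def params_def holds_def
  show ?thesis
    unfolding scan_arcs_def
  proof (rule runs_for[where lo = 1 and hi = hi and I = inv])
    have "h(v := q v) = h" using tight(2) by auto
    then show "inv 1 a"
      unfolding inv_def using a tight by (intro exI[of _ f] exI[of _ "q v"]) auto
    show "1 \<le> hi" by (simp add: hi_def)
  next
    fix a' assume "inv hi a'"
    then obtain f' b where *: "snap t v mn q I q' f' a'" "reg a' rk = Some (Z (int n + 1))"
      "reg a' rbest = Some (Z b)" "tight q (h(v := b)) f'" "b \<le> q v"
      "\<forall>j\<in>{1..<hi}. j \<le> deg v \<longrightarrow> b \<le> r (v, succ v j) + q (succ v j)"
      "b = q v \<or> (\<exists>u. (v, u) \<in> parcs G \<and> b = r (v, u) + q u)" "tm a' \<le> tm a + 20 * deg v + 5"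
      using deg_le[of v] unfolding inv_def hi_def by (auto split: if_splits)
    have "b = relax r q v"
    proof (rule relax_eqI)
      fix u assume "(v, u) \<in> parcs G"
      then obtain k where "k \<in> {1..deg v}" "succ v k = u" using oracle_surj by blast
      then show "b \<le> r (v, u) + q u" using *(6) by (auto simp: hi_def)
    qed (use * in auto)
    moreover have "atest (Less rk rLen) a' = Some False"
      using * by (simp add: simps)
    ultimately show "atest (Less rk rLen) a' = Some False \<and> (\<exists>f'. snap t v mn q I q' f' (atick a') \<and>
        reg (atick a') rbest = Some (Z (relax r q v)) \<and> tight q (h(v := relax r q v)) f' \<and>
        tm (atick a') \<le> tm a + 20 * deg v + 10)"
      using * by auto
  next
    fix k a' assume k: "1 \<le> k" "k < hi" and "inv k a'"
    then obtain f' b where *: "snap t v mn q I q' f' a'" "reg a' rk = Some (Z (int k))"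
      "reg a' rbest = Some (Z b)" "tight q (h(v := b)) f'" "b \<le> q v"
      "\<forall>j\<in>{1..<k}. j \<le> deg v \<longrightarrow> b \<le> r (v, succ v j) + q (succ v j)"
      "b = q v \<or> (\<exists>u. (v, u) \<in> parcs G \<and> b = r (v, u) + q u)" "tm a' \<le> tm a + 20 * (k - 1)"
      unfolding inv_def hi_def by (auto split: if_splits)
    have kn: "k \<le> n" using k deg_le[of v] by (auto simp: hi_def split: if_splits)
    have test: "atest (Less rk rLen) a' = Some True" using * kn by (simp add: simps)
    have small_in: "small (case fst (eo v k) of None \<Rightarrow> Nil_cell | Some e \<Rightarrow> Z (int (fst e)))"
      using oracle_in[OF v, of k] k kn by (auto split: option.splits)
    have "runs (Seq (block [Query_Edge rjunk ru rv rk]) (If (Is_Null ru) (block [Move rk rLen])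
        (Seq relax_arc (block [Arith Add rk rk rOne])))) (atick a') (inv (Suc k))"
    proof (cases "k \<le> deg v")
      case True
      note eo = oracle_arc[OF v, of k]
      define u where "u = succ v k"
      have u: "(v, u) \<in> parcs G" "u \<le> n" "snd (eo v k) = Some (v, u)" 
        using eo k True arc_verts by (auto simp: u_def)
      have "b = q v \<or> (\<exists>u. (v, u) \<in> parcs G \<and> b = r (v, u) + q u)" by fact
      then have b: "\<bar>b\<bar> \<le> bound" using q_bound[OF v] arc_bound by auto
      have "runs (block [Query_Edge rjunk ru rv rk]) (atick a') (\<lambda>c. snap t v mn q I q' f' c \<and>
          reg c rk = Some (Z (int k)) \<and> reg c rbest = Some (Z b) \<and> reg c ru = Some (Z (int u)) \<and> tm c = tm a' + 2)"
        by (rule runs_block, use * v u k kn small_in in \<open>simp add: simps\<close>, use * v u k kn small_in in \<open>simp add: simps\<close>)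
      then show ?thesis
      proof (intro runs_Seq, elim runs_mono, elim conjE)
        fix c assume c: "snap t v mn q I q' f' c" "reg c rk = Some (Z (int k))" "reg c rbest = Some (Z b)"
          "reg c ru = Some (Z (int u))" "tm c = tm a' + 2"
        define x where "x = r (v, u) + q u"
        have "runs relax_arc (atick c) (\<lambda>c'. snap t v mn q I q' (if x < b then f'(v := u) else f') c' \<and>
            reg c' rk = Some (Z (int k)) \<and> reg c' rbest = Some (Z (min b x)) \<and> tm c' \<le> tm (atick c) + 11)"
          unfolding x_def using c u b q_bound arc_bound by (intro runs_relax_arc) auto
        then have "runs (Seq relax_arc (block [Arith Add rk rk rOne])) (atick c) (inv (Suc k))"
        proof (intro runs_Seq, elim runs_mono, elim conjE)
          fix d assume d: "snap t v mn q I q' (if x < b then f'(v := u) else f') d" (is "snap _ _ _ _ _ _ ?f'' _")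
            "reg d rk = Some (Z (int k))" "reg d rbest = Some (Z (min b x))" "tm d \<le> tm (atick c) + 11"
          define d' where "d' = d\<lparr>reg := (reg d)(rk \<mapsto> Z (int k + 1)), tm := Suc (tm d)\<rparr>"
          have "snap t v mn q I q' ?f'' d'" using d unfolding d'_def by (simp add: simps)
          moreover have "tight q (h(v := min b x)) ?f''"
            using *(4) u(1) v unfolding tight_def x_def by auto
          moreover have "min b x \<le> r (v, succ v j) + q (succ v j)" if "j \<in> {1..<Suc k}" "j \<le> deg v" for j
            using *(6) that unfolding x_def u_def by (cases "j = k") auto
          moreover have "min b x = q v \<or> (\<exists>u. (v, u) \<in> parcs G \<and> min b x = r (v, u) + q u)"
            using *(7) u(1) unfolding x_def min_def by auto
          moreover have "tm d' \<le> tm a + 20 * min (Suc k - 1) (deg v)"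
            using *(8) d(4) c(5) True k by (simp add: d'_def)
          ultimately have "inv (Suc k) d'"
            unfolding inv_def using True *(5) d(3)
            by (intro exI[of _ ?f''] exI[of _ "min b x"]) (auto simp: d'_def)
          moreover have "ablock [Arith Add rk rk rOne] d = Some d'"
            using d kn bound_ge(1)[of "Suc k"] unfolding d'_def by (simp add: simps)
          ultimately show "runs (block [Arith Add rk rk rOne]) d (inv (Suc k))"
            by (intro runs_block)
        qed
        then show "runs (If (Is_Null ru) (block [Move rk rLen]) (Seq relax_arc (block [Arith Add rk rk rOne]))) c (inv (Suc k))"
          using c by (intro runs_If(2)) simp_all
      qed
    next
      case False
      have eo: "snd (eo v k) = None" using oracle_None[OF v, of k] False kn by simp
      have k_eq: "k = deg v + 1" "hi = deg v + 2" using False k by (auto simp: hi_def split: if_splits)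
      have "runs (block [Query_Edge rjunk ru rv rk]) (atick a') (\<lambda>c. snap t v mn q I q' f' c \<and>
          reg c rk = Some (Z (int k)) \<and> reg c rbest = Some (Z b) \<and> reg c ru = Some Nil_cell \<and> tm c = tm a' + 2)"
        by (rule runs_block, use * v eo k kn small_in in \<open>simp add: simps\<close>, use * v eo k kn small_in in \<open>simp add: simps\<close>)
      then show ?thesis
      proof (intro runs_Seq, elim runs_mono, elim conjE)
        fix c assume c: "snap t v mn q I q' f' c" "reg c rk = Some (Z (int k))" "reg c rbest = Some (Z b)"
          "reg c ru = Some Nil_cell" "tm c = tm a' + 2"
        define d where "d = c\<lparr>reg := (reg c)(rk \<mapsto> Z (int n + 1)), tm := Suc (Suc (tm c))\<rparr>"
        have "snap t v mn q I q' f' d" using c unfolding d_def by (simp add: simps)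
        then have "inv (Suc k) d"
          unfolding inv_def using * c k_eq
          by (intro exI[of _ f'] exI[of _ b]) (auto simp: d_def)
        moreover have "ablock [Move rk rLen] (atick c) = Some d"
          using c bound_ge(1)[of "Suc n"] unfolding d_def by (simp add: simps)
        ultimately show "runs (If (Is_Null ru) (block [Move rk rLen]) (Seq relax_arc (block [Arith Add rk rk rOne]))) c (inv (Suc k))"
          using c by (intro runs_If(1) runs_block) simp_all
      qed
    qed
    with test show "atest (Less rk rLen) a' = Some True \<and> runs (Seq (block [Query_Edge rjunk ru rv rk])
        (If (Is_Null ru) (block [Move rk rLen]) (Seq relax_arc (block [Arith Add rk rk rOne])))) (atick a') (inv (Suc k))"
      by blast
  qed
qed

lemma runs_relax_vertex:
  assumes a: "snap t v mn q {1..<v} (relax r q) f a" and v: "v \<in> {1..n}"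
    and q: "\<And>i. i \<in> {1..n} \<Longrightarrow> \<bar>q i\<bar> + R \<le> bound" "\<And>i. i \<in> {1..n} \<Longrightarrow> \<bar>relax r q i\<bar> \<le> bound"
    and tight: "tight q (\<lambda>i. if i < v then relax r q i else q i) f"
  shows "runs relax_vertex a (\<lambda>a'. \<exists>f'. snap t (Suc v) mn q {1..<Suc v} (relax r q) f' a' \<and>
    tight q (\<lambda>i. if i < Suc v then relax r q i else q i) f' \<and> tm a' \<le> tm a + 20 * deg v + 20)"
proof -
  note simps = exec_simps snap_def base_def params_def holds_def
  have qv: "\<bar>q v\<bar> \<le> bound" using q(1)[OF v] R(2) by linarith
  let ?h = "\<lambda>i. if i < v then relax r q i else q i"
  have h: "?h(v := relax r q v) = (\<lambda>i. if i < Suc v then relax r q i else q i)" by auto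
  have "runs (block [Arith Add rtmp rP rv, Load rbest rtmp, Const rk 1]) a (\<lambda>b.
      snap t v mn q {1..<v} (relax r q) f b \<and> reg b rk = Some (Z 1) \<and> reg b rbest = Some (Z (q v)) \<and> tm b = tm a + 3)"
    by (rule runs_block, use a v qv in \<open>simp add: simps\<close>, use a v qv in \<open>simp add: simps\<close>)
  then show ?thesis
    unfolding relax_vertex_def
  proof (intro runs_Seq, elim runs_mono, elim conjE)
    fix b assume b: "snap t v mn q {1..<v} (relax r q) f b" "reg b rk = Some (Z 1)"
      "reg b rbest = Some (Z (q v))" "tm b = tm a + 3"
    have scan: "runs scan_arcs b (\<lambda>c. \<exists>f'. snap t v mn q {1..<v} (relax r q) f' c \<and>
        reg c rbest = Some (Z (relax r q v)) \<and> tight q (?h(v := relax r q v)) f' \<and> tm c \<le> tm b + 20 * deg v + 10)"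
      by (rule runs_scan_arcs[OF b(1-3) v _ tight]) (use q(1) in auto)
    show "runs (Seq scan_arcs (block [Arith Add rtmp rQ rv, Store rtmp rbest, Arith Add rv rv rOne])) b
      (\<lambda>a'. \<exists>f'. snap t (Suc v) mn q {1..<Suc v} (relax r q) f' a' \<and>
        tight q (\<lambda>i. if i < Suc v then relax r q i else q i) f' \<and> tm a' \<le> tm a + 20 * deg v + 20)"
    proof (rule runs_Seq, rule runs_mono[OF scan])
      fix c assume "\<exists>f'. snap t v mn q {1..<v} (relax r q) f' c \<and> reg c rbest = Some (Z (relax r q v)) \<and>
        tight q (?h(v := relax r q v)) f' \<and> tm c \<le> tm b + 20 * deg v + 10"
      then obtain f' where c: "snap t v mn q {1..<v} (relax r q) f' c" "reg c rbest = Some (Z (relax r q v))"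
        "tight q (?h(v := relax r q v)) f'" "tm c \<le> tm b + 20 * deg v + 10" by blast
      show "runs (block [Arith Add rtmp rQ rv, Store rtmp rbest, Arith Add rv rv rOne]) c
        (\<lambda>a'. \<exists>f'. snap t (Suc v) mn q {1..<Suc v} (relax r q) f' a' \<and>
          tight q (\<lambda>i. if i < Suc v then relax r q i else q i) f' \<and> tm a' \<le> tm a + 20 * deg v + 20)"
        apply (rule runs_block)
         apply (use c v q(2)[OF v] bound_ge(1)[of "Suc v"] in \<open>simp add: simps\<close>)
        apply (intro exI[of _ f'] conjI)
          apply (use c v in \<open>auto simp add: simps less_Suc_eq\<close>)[1]
         apply (rule c(3)[unfolded h])
        apply (use b(4) c(4) in simp)
        done
    qed
  qed
qed

lemma runs_relax_all:
  assumes a: "snap t 1 mn q {} q' f a"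
    and q: "\<And>i. i \<in> {1..n} \<Longrightarrow> \<bar>q i\<bar> + R \<le> bound" "\<And>i. i \<in> {1..n} \<Longrightarrow> \<bar>relax r q i\<bar> \<le> bound"
    and tight: "tight q q f"
  shows "runs (While (Less rv rLen) relax_vertex) a (\<lambda>a'. \<exists>f'. snap t (Suc n) mn q {1..<Suc n} (relax r q) f' a' \<and>
    tight q (relax r q) f' \<and> tm a' \<le> tm a + 20 * card (parcs G) + 22 * n + 1)"
proof -
  note simps = exec_simps snap_def base_def params_def holds_def
  define inv where "inv v b \<longleftrightarrow> (\<exists>f'. snap t v mn q {1..<v} (relax r q) f' b \<and>
    tight q (\<lambda>i. if i < v then relax r q i else q i) f' \<and>
    tm b \<le> tm a + (\<Sum>i\<in>{1..<v}. 20 * deg i + 22))" for v b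
  show ?thesis
  proof (rule runs_for[where lo = 1 and hi = "Suc n" and I = inv])
    have "tight q (\<lambda>i. if i < 1 then relax r q i else q i) f"
      using tight by (auto simp: tight_def)
    then show "inv 1 a" unfolding inv_def using a by (auto simp: snap_def holds_def)
  next
    fix v b assume v: "1 \<le> v" "v < Suc n" and "inv v b"
    then obtain f' where b: "snap t v mn q {1..<v} (relax r q) f' b"
      "tight q (\<lambda>i. if i < v then relax r q i else q i) f'"
      "tm b \<le> tm a + (\<Sum>i\<in>{1..<v}. 20 * deg i + 22)"
      unfolding inv_def by blast
    have "runs relax_vertex (atick b) (inv (Suc v))"
      by (rule runs_mono[OF runs_relax_vertex[of t v mn q f' "atick b"]])
        (use b v q in \<open>auto simp: inv_def\<close>)
    then show "atest (Less rv rLen) b = Some True \<and> runs relax_vertex (atick b) (inv (Suc v))"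
      using b(1) v by (simp add: simps)
  next
    fix b assume "inv (Suc n) b"
    then obtain f' where b: "snap t (Suc n) mn q {1..<Suc n} (relax r q) f' b"
      "tight q (\<lambda>i. if i < Suc n then relax r q i else q i) f'"
      "tm b \<le> tm a + (\<Sum>i\<in>{1..<Suc n}. 20 * deg i + 22)"
      unfolding inv_def by blast
    have "(\<Sum>i\<in>{1..<Suc n}. 20 * deg i + 22) = 20 * (\<Sum>i\<in>{1..n}. deg i) + 22 * n"
      by (simp add: sum.distrib sum_distrib_left atLeastLessThanSuc_atLeastAtMost)
    moreover have "tight q (relax r q) f'" using b(2) by (auto simp: tight_def)
    moreover have "atest (Less rv rLen) b = Some False" using b(1) by (simp add: simps)
    ultimately show "atest (Less rv rLen) b = Some False \<and> (\<exists>f'. snap t (Suc n) mn q {1..<Suc n} (relax r q) f' (atick b) \<and>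
      tight q (relax r q) f' \<and> tm (atick b) \<le> tm a + 20 * card (parcs G) + 22 * n + 1)"
      using b sum_deg by auto
  qed simp
qed

lemma runs_copy_vertex:
  assumes a: "snap t v mn (\<lambda>i. if i < v then q' i else q i) {1..<Suc n} q' f a" and v: "v \<in> {1..n}"
    and q: "\<And>i. i \<in> {1..n} \<Longrightarrow> \<bar>q' i\<bar> \<le> bound"
  shows "runs copy_vertex a (\<lambda>a'. snap t (Suc v) (min mn (q' v)) (\<lambda>i. if i < Suc v then q' i else q i) {1..<Suc n} q' f a' \<and>
    tm a' \<le> tm a + 10)"
proof -
  note simps = exec_simps snap_def base_def params_def holds_def
  note facts = a v q[OF v] bound_ge(1)[of "Suc v"]
  show ?thesis
    unfolding copy_vertex_def
    apply (rule runs_Seq, rule runs_block)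
     apply (use facts in \<open>simp add: simps\<close>)
    apply (rule runs_Seq)
    apply (cases "q' v < mn")
     apply (rule runs_If(1))
      apply (use facts in \<open>simp add: simps\<close>)
     apply (rule runs_block)
      apply (use facts in \<open>simp add: simps\<close>)
     apply (rule runs_block)
      apply (use facts in \<open>simp add: simps\<close>)
     apply (use facts in \<open>auto simp add: simps less_Suc_eq\<close>)[1]
    apply (rule runs_If(2))
     apply (use facts in \<open>simp add: simps\<close>)
    apply (rule runs_Skip)
    apply (rule runs_block)
     apply (use facts in \<open>simp add: simps\<close>)
    apply (use facts in \<open>auto simp add: simps less_Suc_eq\<close>)[1]
    done
qed

lemma runs_copy_all:
  assumes a: "snap t 1 mn q {1..<Suc n} q' f a"
    and q: "\<And>i. i \<in> {1..n} \<Longrightarrow> \<bar>q' i\<bar> \<le> bound" "q' 0 = q 0"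
  shows "runs (While (Less rv rLen) copy_vertex) a (\<lambda>a'. \<exists>mn'. snap t (Suc n) mn' q' {1..<Suc n} q' f a' \<and>
    (\<forall>i\<in>{1..n}. mn' \<le> q' i) \<and> mn' \<le> mn \<and> (mn' = mn \<or> (\<exists>i\<in>{1..n}. mn' = q' i)) \<and> tm a' \<le> tm a + 11 * n + 1)"
proof -
  note simps = exec_simps snap_def base_def params_def holds_def
  define inv where "inv v b \<longleftrightarrow> (\<exists>mn'. snap t v mn' (\<lambda>i. if i < v then q' i else q i) {1..<Suc n} q' f b \<and>
    (\<forall>i\<in>{1..<v}. mn' \<le> q' i) \<and> mn' \<le> mn \<and> (mn' = mn \<or> (\<exists>i\<in>{1..n}. mn' = q' i)) \<and> tm b \<le> tm a + 11 * (v - 1))" for v b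
  show ?thesis
  proof (rule runs_for[where lo = 1 and hi = "Suc n" and I = inv])
    have "(\<lambda>i. if i < 1 then q' i else q i) = q" using q(2) by auto
    then show "inv 1 a" unfolding inv_def using a by (intro exI[of _ mn]) simp
  next
    fix v b assume v: "1 \<le> v" "v < Suc n" and "inv v b"
    then obtain mn' where b: "snap t v mn' (\<lambda>i. if i < v then q' i else q i) {1..<Suc n} q' f b"
      "\<forall>i\<in>{1..<v}. mn' \<le> q' i" "mn' \<le> mn" "mn' = mn \<or> (\<exists>i\<in>{1..n}. mn' = q' i)" "tm b \<le> tm a + 11 * (v - 1)"
      unfolding inv_def by blast
    have "runs copy_vertex (atick b) (inv (Suc v))"
    proof (rule runs_mono[OF runs_copy_vertex[of t v mn' q' q f "atick b"]])
      fix c assume "snap t (Suc v) (min mn' (q' v)) (\<lambda>i. if i < Suc v then q' i else q i) {1..<Suc n} q' f c \<and>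
        tm c \<le> tm (atick b) + 10"
      moreover have "min mn' (q' v) \<le> q' i" if "i \<in> {1..<Suc v}" for i
        using b(2) that by (cases "i = v") (auto simp: min_le_iff_disj)
      moreover have "min mn' (q' v) = mn \<or> (\<exists>i\<in>{1..n}. min mn' (q' v) = q' i)"
        using b(4) v by (cases "mn' \<le> q' v") (auto simp: min_def)
      moreover have "min mn' (q' v) \<le> mn" using b(3) by (simp add: min_le_iff_disj)
      ultimately show "inv (Suc v) c"
        unfolding inv_def using b(5) v by (intro exI[of _ "min mn' (q' v)"]) auto
    qed (use b v q in auto)
    then show "atest (Less rv rLen) b = Some True \<and> runs copy_vertex (atick b) (inv (Suc v))"
      using b(1) v by (simp add: simps)
  next
    fix b assume "inv (Suc n) b"
    then obtain mn' where b: "snap t (Suc n) mn' (\<lambda>i. if i < Suc n then q' i else q i) {1..<Suc n} q' f b"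
      "\<forall>i\<in>{1..<Suc n}. mn' \<le> q' i" "mn' \<le> mn" "mn' = mn \<or> (\<exists>i\<in>{1..n}. mn' = q' i)" "tm b \<le> tm a + 11 * n"
      unfolding inv_def by auto
    have "snap t (Suc n) mn' q' {1..<Suc n} q' f b" using b(1) by (simp add: snap_def holds_def)
    moreover have "atest (Less rv rLen) b = Some False" using b(1) by (simp add: simps)
    ultimately show "atest (Less rv rLen) b = Some False \<and> (\<exists>mn'. snap t (Suc n) mn' q' {1..<Suc n} q' f (atick b) \<and>
      (\<forall>i\<in>{1..n}. mn' \<le> q' i) \<and> mn' \<le> mn \<and> (mn' = mn \<or> (\<exists>i\<in>{1..n}. mn' = q' i)) \<and> tm (atick b) \<le> tm a + 11 * n + 1)"
      using b(2-) by auto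
  qed simp
qed

lemma runs_round:
  assumes a: "snap t (Suc n) mn q {} q' f a" and t: "t < T"
    and q: "\<And>i. i \<in> {1..n} \<Longrightarrow> \<bar>q i\<bar> + R \<le> bound" "\<And>i. i \<in> {1..n} \<Longrightarrow> \<bar>relax r q i\<bar> \<le> bound"
    and tight: "tight q q f"
  shows "runs round a (\<lambda>a'. \<exists>f' mn'. snap (Suc t) (Suc n) mn' (relax r q) {} q' f' a' \<and>
    tight (relax r q) (relax r q) f' \<and> (\<forall>i\<in>{1..n}. mn' \<le> relax r q i) \<and> mn' \<le> mn \<and>
    (mn' = mn \<or> (\<exists>i\<in>{1..n}. mn' = relax r q i)) \<and> tm a' \<le> tm a + 60 * card (parcs G))"
proof -
  note simps = exec_simps snap_def base_def params_def holds_def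
  \<comment> \<open>The copy loop skips index 0, so array 0 equals \<open>relax r q\<close> on all
    of \<open>{..n}\<close> only because 0 has no arcs.\<close>
  have "parcs G `` {0} = {}" using arc_verts by auto
  then have relax_0: "relax r q 0 = q 0" by (simp add: relax_def)
  define post where "post a' \<longleftrightarrow> (\<exists>f' mn'. snap (Suc t) (Suc n) mn' (relax r q) {} q' f' a' \<and>
    tight (relax r q) (relax r q) f' \<and> (\<forall>i\<in>{1..n}. mn' \<le> relax r q i) \<and> mn' \<le> mn \<and>
    (mn' = mn \<or> (\<exists>i\<in>{1..n}. mn' = relax r q i)) \<and> tm a' \<le> tm a + 60 * card (parcs G))" for a'
  have "runs (block [Const rv 1]) a (\<lambda>b. snap t 1 mn q {} q' f b \<and> tm b = tm a + 1)"
    by (rule runs_block, use a in \<open>simp add: simps\<close>, use a in \<open>simp add: simps\<close>)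
  then have "runs round a post"
    unfolding round_def
  proof (intro runs_Seq, elim runs_mono, elim conjE)
    fix b assume b: "snap t 1 mn q {} q' f b" "tm b = tm a + 1"
    show "runs (Seq (While (Less rv rLen) relax_vertex) (Seq (block [Const rv 1])
      (Seq (While (Less rv rLen) copy_vertex) (block [Arith Add rt rt rOne])))) b post"
    proof (rule runs_Seq, rule runs_mono[OF runs_relax_all[OF b(1) q tight]], assumption, assumption, elim exE conjE)
      fix c f' assume c: "snap t (Suc n) mn q {1..<Suc n} (relax r q) f' c" "tight q (relax r q) f'"
        "tm c \<le> tm b + 20 * card (parcs G) + 22 * n + 1"
      have "runs (block [Const rv 1]) c (\<lambda>d. snap t 1 mn q {1..<Suc n} (relax r q) f' d \<and> tm d = tm c + 1)"
        by (rule runs_block, use c in \<open>simp add: simps\<close>, use c in \<open>simp add: simps\<close>)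
      then show "runs (Seq (block [Const rv 1]) (Seq (While (Less rv rLen) copy_vertex) (block [Arith Add rt rt rOne]))) c post"
      proof (intro runs_Seq, elim runs_mono, elim conjE)
        fix d assume d: "snap t 1 mn q {1..<Suc n} (relax r q) f' d" "tm d = tm c + 1"
        show "runs (Seq (While (Less rv rLen) copy_vertex) (block [Arith Add rt rt rOne])) d post"
        proof (rule runs_Seq, rule runs_mono[OF runs_copy_all[OF d(1) q(2) relax_0]], assumption, elim exE conjE)
          fix e mn' assume e: "snap t (Suc n) mn' (relax r q) {1..<Suc n} (relax r q) f' e"
            and mn': "\<forall>i\<in>{1..n}. mn' \<le> relax r q i" "mn' \<le> mn" "mn' = mn \<or> (\<exists>i\<in>{1..n}. mn' = relax r q i)"
            and time: "tm e \<le> tm d + 11 * n + 1"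
          define e' where "e' = e\<lparr>reg := (reg e)(rt \<mapsto> Z (int t + 1)), tm := Suc (tm e)\<rparr>"
          have "snap (Suc t) (Suc n) mn' (relax r q) {} q' f' e'"
            using e unfolding e'_def by (simp add: simps)
          \<comment> \<open>The potential of the successor may drop after the pointer was set. The
            inequality in \<open>tight\<close> survives this; an equality would not.\<close>
          moreover have "tight (relax r q) (relax r q) f'"
            unfolding tight_def
          proof (intro conjI ballI)
            fix v assume "v \<in> {1..n}"
            then have "f' v = 0 \<and> relax r q v = p0 v \<or> (v, f' v) \<in> parcs G \<and> r (v, f' v) + q (f' v) \<le> relax r q v"
              using c(2) unfolding tight_def by blast
            then show "f' v = 0 \<and> relax r q v = p0 v \<or>
                (v, f' v) \<in> parcs G \<and> r (v, f' v) + relax r q (f' v) \<le> relax r q v"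
              using relax_le[of r q "f' v"] by linarith
          qed (use c(2) in \<open>simp add: tight_def\<close>)
          moreover have "tm e' \<le> tm a + 60 * card (parcs G)"
            using b(2) c(3) d(2) time n_le n_pos by (simp add: e'_def)
          ultimately have "post e'" unfolding post_def using mn' by blast
          moreover have "ablock [Arith Add rt rt rOne] e = Some e'"
            using e t T_le unfolding e'_def by (simp add: simps)
          ultimately show "runs (block [Arith Add rt rt rOne]) e post" by (intro runs_block)
        qed
      qed
    qed
  qed
  then show ?thesis unfolding post_def .
qed

lemma pt_bound: "t \<le> T \<Longrightarrow> i \<in> {1..n} \<Longrightarrow> \<bar>pt t i\<bar> + R \<le> bound"
proof -
  assume t: "t \<le> T" and i: "i \<in> {1..n}"
  have "\<bar>pt t i\<bar> \<le> \<bar>B\<bar> + int t * R"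
    using i R by (intro pot_abs_le) (auto simp: verts p0_def)
  also have "int t * R \<le> int T * R" using t R(2) by (intro mult_right_mono) auto
  finally show ?thesis using B_le by (simp add: algebra_simps)
qed

text \<open>\<open>mn\<close> is controlled from both sides: as a lower bound on the potentials it
  makes the certificate valid, and the disjunction keeps it from being too low, as needed for
  success on long horizons. The guard \<open>0 < k\<close> is there because \<open>mn\<close> is
  compared with potentials only when a round copies them.\<close>

definition bf_post :: "astate \<Rightarrow> nat \<Rightarrow> astate \<Rightarrow> bool" where
  "bf_post a k a' \<longleftrightarrow> (\<exists>mn f. base a' \<and> params T S M B a' \<and> reg a' rmin = Some (Z mn) \<and>
     holds a' 2 {..n} (int \<circ> f) \<and> tight (pt k) (pt k) f \<and> (0 < k \<longrightarrow> (\<forall>i\<in>{1..n}. mn \<le> pt k i)) \<and> mn \<le> 0 \<and>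
     (mn = 0 \<or> (\<exists>i\<in>{1..n}. pt k i \<le> mn)) \<and> tm a' \<le> tm a + 100 * card (parcs G) * (k + 1))"

lemma runs_bellman_ford:
  assumes a: "base a" "params T S M B a"
  shows "runs bellman_ford a (bf_post a T)"
proof -
  note simps = exec_simps snap_def base_def params_def holds_def
  have B: "\<bar>B\<bar> \<le> bound" using B_le R(2) by (smt (verit) mult_nonneg_nonneg of_nat_0_le_iff)
  define inv where "inv v b \<longleftrightarrow> base b \<and> params T S M B b \<and> reg b rmin = Some (Z 0) \<and> reg b rv = Some (Z (int v)) \<and>
    holds b 0 {..<v} (\<lambda>_. B) \<and> holds b 2 {..<v} (\<lambda>_. 0) \<and> tm b \<le> tm a + 2 + 6 * v" for v b
  define start where "start b \<longleftrightarrow> snap 0 (Suc n) 0 p0 {} (\<lambda>_. 0) (\<lambda>_. 0) b \<and> tm b \<le> tm a + 6 * n + 12" for b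
  have init: "runs (block [Const rmin 0, Const rv 0]) a (inv 0)"
    apply (rule runs_block)
     apply (use a in \<open>simp add: simps\<close>)
    apply (use a in \<open>simp add: simps inv_def\<close>)
    done
  have fill: "runs (While (Less rv rLen) (block [Arith Add rtmp rP rv, Store rtmp rB,
        Arith Add rtmp rF rv, Store rtmp rZero, Arith Add rv rv rOne])) b
      (\<lambda>b. runs (block [Arith Add rtmp rP rOne, Store rtmp rZero, Const rt 0]) b start)" if "inv 0 b" for b
  proof (rule runs_for[where lo = 0 and hi = "Suc n" and I = inv])
    fix v b assume v: "v < Suc n" and b: "inv v b"
    have "runs (block [Arith Add rtmp rP rv, Store rtmp rB,
        Arith Add rtmp rF rv, Store rtmp rZero, Arith Add rv rv rOne]) (atick b) (inv (Suc v))"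
      apply (rule runs_block)
       apply (use v b B bound_ge(1)[of "Suc v"] in \<open>simp add: simps inv_def\<close>)
      apply (use v b in \<open>auto simp: simps inv_def less_Suc_eq\<close>)
      done
    then show "atest (Less rv rLen) b = Some True \<and> runs (block [Arith Add rtmp rP rv, Store rtmp rB,
        Arith Add rtmp rF rv, Store rtmp rZero, Arith Add rv rv rOne]) (atick b) (inv (Suc v))"
      using v b by (simp add: simps inv_def)
  next
    fix b assume b: "inv (Suc n) b"
    have "runs (block [Arith Add rtmp rP rOne, Store rtmp rZero, Const rt 0]) (atick b) start"
      apply (rule runs_block)
       apply (use n_pos b in \<open>simp add: simps inv_def\<close>)
      apply (use n_pos b in \<open>auto simp: simps inv_def start_def p0_def less_Suc_eq_le\<close>)
      done
    then show "atest (Less rv rLen) b = Some False \<and>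
        runs (block [Arith Add rtmp rP rOne, Store rtmp rZero, Const rt 0]) (atick b) start"
      using b by (simp add: simps inv_def)
  qed (use that in auto)
  have rounds: "runs (While (Less rt rT) round) b (bf_post a T)" if "start b" for b
  proof -
    define J where "J t c \<longleftrightarrow> (\<exists>mn f. snap t (Suc n) mn (pt t) {} (\<lambda>_. 0) f c \<and> tight (pt t) (pt t) f \<and>
      (0 < t \<longrightarrow> (\<forall>i\<in>{1..n}. mn \<le> pt t i)) \<and> mn \<le> 0 \<and> (mn = 0 \<or> (\<exists>i\<in>{1..n}. pt t i \<le> mn)) \<and>
      tm c \<le> tm a + 6 * n + 12 + (60 * card (parcs G) + 1) * t)" for t c
    show ?thesis
    proof (rule runs_for[where lo = 0 and hi = T and I = J])
      show "J 0 b" unfolding J_def using that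
        by (intro exI[of _ 0] exI[of _ "\<lambda>_. 0"]) (auto simp: start_def tight_def)
    next
      fix t c assume t: "t < T" and "J t c"
      then obtain mn f where c: "snap t (Suc n) mn (pt t) {} (\<lambda>_. 0) f c" "tight (pt t) (pt t) f"
        "mn \<le> 0" "mn = 0 \<or> (\<exists>i\<in>{1..n}. pt t i \<le> mn)"
        "tm c \<le> tm a + 6 * n + 12 + (60 * card (parcs G) + 1) * t"
        unfolding J_def by blast
      have pt: "\<bar>pt t i\<bar> + R \<le> bound" "\<bar>relax r (pt t) i\<bar> \<le> bound" if "i \<in> {1..n}" for i
        using pt_bound[of t i] pt_bound[of "Suc t" i] that t R(2) by auto
      have "runs round (atick c) (J (Suc t))"
      proof (rule runs_mono[OF runs_round[of t mn "pt t" "\<lambda>_. 0" f "atick c", OF _ t pt c(2)]])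
        fix d assume "\<exists>f' mn'. snap (Suc t) (Suc n) mn' (relax r (pt t)) {} (\<lambda>_. 0) f' d \<and>
          tight (relax r (pt t)) (relax r (pt t)) f' \<and> (\<forall>i\<in>{1..n}. mn' \<le> relax r (pt t) i) \<and> mn' \<le> mn \<and>
          (mn' = mn \<or> (\<exists>i\<in>{1..n}. mn' = relax r (pt t) i)) \<and> tm d \<le> tm (atick c) + 60 * card (parcs G)"
        then obtain f' mn' where d: "snap (Suc t) (Suc n) mn' (pt (Suc t)) {} (\<lambda>_. 0) f' d"
          "tight (pt (Suc t)) (pt (Suc t)) f'" "\<forall>i\<in>{1..n}. mn' \<le> pt (Suc t) i" "mn' \<le> mn"
          "mn' = mn \<or> (\<exists>i\<in>{1..n}. mn' = pt (Suc t) i)" "tm d \<le> tm (atick c) + 60 * card (parcs G)"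
          by auto
        have "mn' = 0 \<or> (\<exists>i\<in>{1..n}. pt (Suc t) i \<le> mn')"
          using d(5) c(4) relax_le[of r "pt t"] by (auto intro: order_trans)
        moreover have "tm d \<le> tm a + 6 * n + 12 + (60 * card (parcs G) + 1) * Suc t"
          using d(6) c(5) by simp
        ultimately show "J (Suc t) d"
          unfolding J_def using d(1-4) c(3) by (intro exI[of _ mn'] exI[of _ f']) auto
      qed (use c in auto)
      then show "atest (Less rt rT) c = Some True \<and> runs round (atick c) (J (Suc t))"
        using c(1) t by (simp add: simps)
    next
      fix c assume "J T c"
      then obtain mn f where c: "snap T (Suc n) mn (pt T) {} (\<lambda>_. 0) f c" "tight (pt T) (pt T) f"
        "0 < T \<longrightarrow> (\<forall>i\<in>{1..n}. mn \<le> pt T i)" "mn \<le> 0" "mn = 0 \<or> (\<exists>i\<in>{1..n}. pt T i \<le> mn)"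
        "tm c \<le> tm a + 6 * n + 12 + (60 * card (parcs G) + 1) * T"
        unfolding J_def by blast
      have "T \<le> card (parcs G) * T" using n_le n_pos by (cases "card (parcs G)") auto
      moreover have "100 * card (parcs G) * (T + 1) = 100 * card (parcs G) + 100 * (card (parcs G) * T)"
        "(60 * card (parcs G) + 1) * T = 60 * (card (parcs G) * T) + T" by (simp_all add: algebra_simps)
      ultimately have "tm (atick c) \<le> tm a + 100 * card (parcs G) * (T + 1)"
        using c(6) n_le n_pos atick_simps(3)[of c] by linarith
      then have "bf_post a T (atick c)"
        unfolding bf_post_def using c by (intro exI[of _ mn] exI[of _ f]) (auto simp: snap_def base_def params_def holds_def)
      moreover have "atest (Less rt rT) c = Some False"
        using c(1) by (simp add: simps)
      ultimately show "atest (Less rt rT) c = Some False \<and> bf_post a T (atick c)" by blast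
    qed simp
  qed
  show ?thesis
    unfolding bellman_ford_def
    apply (rule runs_Seq, rule runs_mono[OF init])
    apply (rule runs_Seq, rule runs_mono[OF fill], assumption)
    apply (rule runs_Seq, erule runs_mono, erule rounds)
    done
qed

end

section \<open>From successor pointers to a cycle\<close>

lemma sum_list_le_telescope:
  fixes h :: "'b \<Rightarrow> int"
  assumes "\<And>e. e \<in> set q \<Longrightarrow> h e + b e \<le> a e" "(\<Sum>e\<leftarrow>q. a e) = (\<Sum>e\<leftarrow>q. b e)"
  shows "sum_list (map h q) \<le> 0"
proof -
  have "(\<Sum>e\<leftarrow>q. h e + b e) \<le> (\<Sum>e\<leftarrow>q. a e)" by (intro sum_list_mono assms(1))
  then show ?thesis using assms(2) by (simp add: sum_list_addf)
qed

text \<open>As 0 is absorbing, \<open>x \<noteq> 0\<close> keeps the first \<open>n + 1\<close>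
  iterates within \<open>{1..n}\<close>, so two of them coincide and the \<open>n\<close>-th already
  lies on the periodic part. \<open>L\<close> is chosen as the least period, which gives
  injectivity.\<close>

lemma funpow_periodic:
  fixes f :: "nat \<Rightarrow> nat"
  assumes f: "f 0 = 0" "\<And>v. v \<le> n \<Longrightarrow> f v \<le> n" and v: "v \<le> n" and x: "x = (f ^^ n) v" "x \<noteq> 0"
  obtains L where "0 < L" "L \<le> n" "(f ^^ L) x = x" "inj_on (\<lambda>i. (f ^^ i) x) {..<L}"
    "\<And>i. (f ^^ i) x \<in> {1..n}"
proof -
  have le: "(f ^^ i) u \<le> n" if "u \<le> n" for i u
    using that f(2) by (induction i) auto
  have zero: "(f ^^ i) 0 = 0" for i
    using f(1) by (induction i) auto
  have ne: "(f ^^ i) v \<noteq> 0" if "i \<le> n" for i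
  proof
    assume "(f ^^ i) v = 0"
    then have "(f ^^ (n - i + i)) v = 0" unfolding funpow_add using zero by simp
    then show False using x that by simp
  qed
  have "\<not> inj_on (\<lambda>i. (f ^^ i) v) {..n}"
  proof
    assume "inj_on (\<lambda>i. (f ^^ i) v) {..n}"
    then have "card {..n} \<le> card {1..n}"
      by (rule card_inj_on_le) (use ne le[OF v] in \<open>auto simp: Suc_le_eq\<close>)
    then show False by simp
  qed
  then obtain i j where ij: "i < j" "j \<le> n" "(f ^^ i) v = (f ^^ j) v"
    unfolding inj_on_def by (metis atMost_iff linorder_neq_iff)
  have "(f ^^ (j - i)) x = (f ^^ (n - i)) ((f ^^ j) v)"
    unfolding x(1) funpow_add[symmetric, THEN fun_cong, unfolded comp_def] using ij by (simp add: add.commute)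
  also have "\<dots> = (f ^^ (n - i)) ((f ^^ i) v)" using ij by simp
  also have "\<dots> = x"
    unfolding x(1) funpow_add[symmetric, THEN fun_cong, unfolded comp_def] using ij by (simp add: add.commute)
  finally have ex: "\<exists>L>0. (f ^^ L) x = x" using ij by (intro exI[of _ "j - i"]) auto
  define L where "L = (LEAST L. 0 < L \<and> (f ^^ L) x = x)"
  have L: "0 < L" "(f ^^ L) x = x" using LeastI_ex[OF ex] by (auto simp: L_def)
  have L_min: "(f ^^ k) x \<noteq> x" if "0 < k" "k < L" for k
    using not_less_Least[of k "\<lambda>L. 0 < L \<and> (f ^^ L) x = x"] that by (auto simp: L_def)
  have inj: "inj_on (\<lambda>i. (f ^^ i) x) {..<L}"
  proof (rule linorder_inj_onI)
    fix i j assume ij: "i < j" "i \<in> {..<L}" "j \<in> {..<L}"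
    show "(f ^^ i) x \<noteq> (f ^^ j) x"
    proof
      assume "(f ^^ i) x = (f ^^ j) x"
      then have "(f ^^ (L - j + i)) x = (f ^^ (L - j + j)) x" unfolding funpow_add by simp
      moreover have "0 < L - j + i" "L - j + i < L" "L - j + j = L" using ij by auto
      ultimately show False using L(2) L_min[of "L - j + i"] by metis
    qed
  qed auto
  have x_le: "x \<le> n" using le[OF v] x by simp
  have pos: "(f ^^ i) x \<in> {1..n}" for i
  proof -
    \<comment> \<open>Iterating on from \<open>i\<close> to \<open>i * L\<close> returns to
      \<open>x \<noteq> 0\<close>, which would be impossible after reaching 0.\<close>
    have "(f ^^ (i * L)) x = x" using L by (induction i) (auto simp: funpow_add)
    moreover have "(f ^^ (i * L - i + i)) x = (f ^^ (i * L - i)) ((f ^^ i) x)" unfolding funpow_add by simp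
    moreover have "i \<le> i * L" using L by (cases L) auto
    ultimately have "(f ^^ i) x \<noteq> 0" using zero x(2) by (metis le_add_diff_inverse2)
    then show ?thesis using le[OF x_le] by (simp add: Suc_le_eq)
  qed
  have "card {..<L} \<le> card {1..n}"
    by (rule card_inj_on_le[OF inj]) (use pos in auto)
  then show ?thesis using that L inj pos by simp
qed

context pair_fin_digraph
begin

lemma awalk_map_upt:
  assumes "\<And>i. i < k \<Longrightarrow> (h i, h (Suc i)) \<in> parcs G" "h 0 \<in> pverts G"
  shows "awalk (h 0) (map (\<lambda>i. (h i, h (Suc i))) [0..<k]) (h k)"
  using assms(1)
proof (induction k)
  case (Suc k)
  then have "(h k, h (Suc k)) \<in> parcs G" "awalk (h 0) (map (\<lambda>i. (h i, h (Suc i))) [0..<k]) (h k)" by auto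
  then show ?case by (auto simp: awalk_Cons_iff awalk_Nil_iff dest: in_arcsD1 in_arcsD2)
qed (use assms(2) in \<open>simp add: awalk_Nil_iff\<close>)

text \<open>Links the output format to pointers: rotating the list of iterates by one pairs each
  with its image, and the last pair closes because \<open>(f ^^ L) x = x\<close>.\<close>

lemma cycle_of_funpow:
  assumes L: "0 < L" "(f ^^ L) x = x" "inj_on (\<lambda>i. (f ^^ i) x) {..<L}"
    and arcs: "\<And>i. ((f ^^ i) x, (f ^^ Suc i) x) \<in> parcs G"
  defines "vs \<equiv> map (\<lambda>i. (f ^^ i) x) [0..<L]"
  shows "cycle (zip vs (rotate1 vs))" "set (zip vs (rotate1 vs)) \<subseteq> range (\<lambda>i. ((f ^^ i) x, (f ^^ Suc i) x))"
proof -
  let ?p = "map (\<lambda>i. ((f ^^ i) x, (f ^^ Suc i) x)) [0..<L]"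
  have p: "zip vs (rotate1 vs) = ?p"
  proof (rule nth_equalityI)
    fix i assume "i < length (zip vs (rotate1 vs))"
    then have i: "i < L" by (simp add: vs_def)
    show "zip vs (rotate1 vs) ! i = ?p ! i"
      using i L by (cases "Suc i = L") (auto simp: vs_def nth_rotate1 simp del: funpow.simps)
  qed (simp add: vs_def)
  have "awalk ((f ^^ 0) x) ?p ((f ^^ L) x)"
    using arcs arcs[of 0] by (intro awalk_map_upt) (auto dest: in_arcsD1)
  then have walk: "awalk x ?p x" using L(2) by simp
  have "tl (pawalk_verts x ?p) = map (\<lambda>i. (f ^^ Suc i) x) [0..<L]"
    using walk L(1) by (subst awalk_verts_conv'[of x _ x]) (auto simp: awalk_def)
  moreover have "distinct (map (\<lambda>i. (f ^^ Suc i) x) [0..<L])"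
  proof -
    have "inj_on (\<lambda>i. (f ^^ Suc i) x) {0..<L}"
    proof (rule linorder_inj_onI)
      fix i j assume ij: "i < j" "i \<in> {0..<L}" "j \<in> {0..<L}"
      \<comment> \<open>\<open>cycle\<close> asks for distinct vertices without the first one, that
        is, iterates 1 to \<open>L\<close>; iterate \<open>L\<close> is renamed to 0 so that
        injectivity on \<open>{..<L}\<close> applies.\<close>
      have eq: "(f ^^ Suc j) x = (f ^^ (if Suc j = L then 0 else Suc j)) x" using L by auto
      show "(f ^^ Suc i) x \<noteq> (f ^^ Suc j) x"
      proof
        assume "(f ^^ Suc i) x = (f ^^ Suc j) x"
        then have "Suc i = (if Suc j = L then 0 else Suc j)"
          using ij unfolding eq by (intro inj_onD[OF L(3)]) auto
        then show False using ij by (auto split: if_splits)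
      qed
    qed auto
    then show ?thesis by (simp add: distinct_map)
  qed
  ultimately show "cycle (zip vs (rotate1 vs))"
    unfolding cycle_def p using walk L(1) by auto
  show "set (zip vs (rotate1 vs)) \<subseteq> range (\<lambda>i. ((f ^^ i) x, (f ^^ Suc i) x))"
    unfolding p by auto
qed

end

context rounding
begin

lemma runs_follow:
  assumes a: "base a" "reg a rT = Some (Z T)" "holds a 2 {..n} (int \<circ> f)" and f: "\<And>v. v \<le> n \<Longrightarrow> f v \<le> n"
  shows "runs follow a (\<lambda>b. base b \<and> reg b rT = Some (Z T) \<and> holds b 2 {..n} (int \<circ> f) \<and>
    reg b rx = Some (Z (int ((f ^^ n) 1))) \<and> tm b \<le> tm a + 4 * n + 3)"
proof -
  note simps = exec_simps base_def holds_def
  have le: "(f ^^ i) 1 \<le> n" for i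
    using n_pos f by (induction i) auto
  define inv where "inv i b \<longleftrightarrow> base b \<and> reg b rT = Some (Z T) \<and> holds b 2 {..n} (int \<circ> f) \<and>
    reg b rx = Some (Z (int ((f ^^ i) 1))) \<and> reg b ri = Some (Z (int i)) \<and> tm b \<le> tm a + 4 * i + 2" for i b
  have init: "runs (block [Const rx 1, Const ri 0]) a (inv 0)"
    apply (rule runs_block)
     apply (use a in \<open>simp add: simps\<close>)
    apply (use a in \<open>simp add: simps inv_def\<close>)
    done
  have loop: "runs (While (Less ri rN) (block [Arith Add rtmp rF rx, Load rx rtmp, Arith Add ri ri rOne])) b
      (\<lambda>b. base b \<and> reg b rT = Some (Z T) \<and> holds b 2 {..n} (int \<circ> f) \<and>
        reg b rx = Some (Z (int ((f ^^ n) 1))) \<and> tm b \<le> tm a + 4 * n + 3)" if "inv 0 b" for b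
  proof (rule runs_for[where lo = 0 and hi = n and I = inv])
    fix i b assume i: "i < n" and b: "inv i b"
    have "runs (block [Arith Add rtmp rF rx, Load rx rtmp, Arith Add ri ri rOne]) (atick b) (inv (Suc i))"
      apply (rule runs_block)
       apply (use i b le[of i] f[OF le[of i]] bound_ge(1)[of "Suc i"] in \<open>simp add: simps inv_def\<close>)
      apply (use i b in \<open>simp add: simps inv_def\<close>)
      done
    then show "atest (Less ri rN) b = Some True \<and>
        runs (block [Arith Add rtmp rF rx, Load rx rtmp, Arith Add ri ri rOne]) (atick b) (inv (Suc i))"
      using i b by (simp add: simps inv_def)
  next
    fix b assume "inv n b"
    then show "atest (Less ri rN) b = Some False \<and> base (atick b) \<and> reg (atick b) rT = Some (Z T) \<and>
        holds (atick b) 2 {..n} (int \<circ> f) \<and> reg (atick b) rx = Some (Z (int ((f ^^ n) 1))) \<and>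
        tm (atick b) \<le> tm a + 4 * n + 3"
      by (simp add: simps inv_def)
  qed (use that in auto)
  show ?thesis
    unfolding follow_def by (rule runs_Seq, rule runs_mono[OF init], rule loop)
qed

lemma runs_output_cycle:
  assumes a: "base a" "holds a 2 {..n} (int \<circ> f)" "reg a rx = Some (Z (int x))"
    and L: "0 < L" "L \<le> n" "(f ^^ L) x = x" "inj_on (\<lambda>i. (f ^^ i) x) {..<L}" "\<And>i. (f ^^ i) x \<in> {1..n}"
  shows "runs output_cycle a (\<lambda>b. reg b rN = Some (Z (int L)) \<and> reg b rEps = Some (Z (int (slot n 1 0))) \<and>
    holds b 1 {..<L} (\<lambda>i. int ((f ^^ i) x)) \<and> tm b \<le> tm a + 9 * n + 6)"
proof -
  note simps = exec_simps base_def holds_def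
  have ne: "(f ^^ i) x \<noteq> (f ^^ j) x" if "i < j" "j < L" for i j
    using inj_onD[OF L(4), of i j] that by auto
  define inv where "inv i b \<longleftrightarrow> base b \<and> reg b rx = Some (Z (int ((f ^^ i) x))) \<and> reg b ri = Some (Z (int i)) \<and>
    reg b ru = Some (Z (if i < L then int ((f ^^ Suc i) x) else 0)) \<and>
    holds b 1 {..<i} (\<lambda>i. int ((f ^^ i) x)) \<and> holds b 2 {..n} (\<lambda>v. if \<exists>j<i. v = (f ^^ j) x then 0 else int (f v)) \<and>
    tm b \<le> tm a + 3 + 9 * i" for i b
  have x: "x \<le> n" "f x \<le> n" using L(5)[of 0] L(5)[of 1] by auto
  have init: "runs (block [Const ri 0, Arith Add rtmp rF rx, Load ru rtmp]) a (inv 0)"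
    apply (rule runs_block)
     apply (use a x in \<open>simp add: simps\<close>)
    apply (use a L in \<open>simp add: simps inv_def\<close>)
    done
  let ?body = "block [Arith Add rtmp rQ ri, Store rtmp rx, Arith Add rtmp rF rx, Store rtmp rZero,
    Move rx ru, Arith Add rtmp rF rx, Load ru rtmp, Arith Add ri ri rOne]"
  have loop: "runs (While (Less rZero ru) ?body) b
      (\<lambda>b. runs (block [Move rN ri, Move rEps rQ]) b (\<lambda>b. reg b rN = Some (Z (int L)) \<and>
        reg b rEps = Some (Z (int (slot n 1 0))) \<and>
        holds b 1 {..<L} (\<lambda>i. int ((f ^^ i) x)) \<and> tm b \<le> tm a + 9 * n + 6))" if "inv 0 b" for b
  proof (rule runs_for[where lo = 0 and hi = L and I = inv])
    fix i b assume i: "i < L" and b: "inv i b"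
    define y where "y = (f ^^ i) x"
    have y: "y \<le> n" "f y \<le> n" "0 < f y" using L(5)[of i] L(5)[of "Suc i"] by (auto simp: y_def)
    have b': "base b" "reg b rx = Some (Z (int y))" "reg b ri = Some (Z (int i))" "reg b ru = Some (Z (int (f y)))"
      "holds b 1 {..<i} (\<lambda>i. int ((f ^^ i) x))" "holds b 2 {..n} (\<lambda>v. if \<exists>j<i. v = (f ^^ j) x then 0 else int (f v))"
      "tm b \<le> tm a + 3 + 9 * i"
      using b i by (auto simp: inv_def y_def)
    define F' where "F' = (\<lambda>v. if \<exists>j<Suc i. v = (f ^^ j) x then 0 else int (f v))"
    have F': "F' v = (if v = y then 0 else if \<exists>j<i. v = (f ^^ j) x then 0 else int (f v))" for v
      by (auto simp: F'_def y_def less_Suc_eq)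
    have F'_next: "F' (f y) = (if Suc i < L then int (f (f y)) else 0)"
    proof (cases "Suc i < L")
      case True
      then have "f y \<noteq> (f ^^ j) x" if "j < Suc i" for j
        using ne[of j "Suc i"] that by (auto simp: y_def)
      then show ?thesis using True by (auto simp: F'_def)
    next
      case False
      then have "L = Suc i" using i by simp
      then have "f y = (f ^^ 0) x" using L(3) by (simp add: y_def)
      then show ?thesis using False by (auto simp: F'_def)
    qed
    have F'_bound: "\<bar>F' (f y)\<bar> \<le> bound"
      using F'_next L(5)[of "Suc (Suc i)"] by (auto simp: y_def)
    \<comment> \<open>At a loop arc the pointer read next is the one just erased, hence the case
      distinction.\<close>
    have read: "(if f y = y then Some (Z 0) else arr b 2 (f y)) = Some (Z (F' (f y)))"
      using b'(6) y by (auto simp: holds_def F')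
    have "runs ?body (atick b) (inv (Suc i))"
      apply (rule runs_block)
       apply (use b'(1-4) i y L(2) read F'_bound bound_ge(1)[of "Suc i"] in \<open>simp add: simps\<close>)
      unfolding inv_def F'_def[symmetric]
      apply (use b' i y F'_next in \<open>auto simp: simps F' less_Suc_eq y_def\<close>)
      done
    then show "atest (Less rZero ru) b = Some True \<and> runs ?body (atick b) (inv (Suc i))"
      using b' y by (simp add: simps)
  next
    fix b assume "inv L b"
    then have b': "base b" "reg b ri = Some (Z (int L))" "reg b ru = Some (Z 0)"
      "holds b 1 {..<L} (\<lambda>i. int ((f ^^ i) x))" "tm b \<le> tm a + 3 + 9 * L"
      by (auto simp: inv_def)
    have "runs (block [Move rN ri, Move rEps rQ]) (atick b) (\<lambda>b. reg b rN = Some (Z (int L)) \<and>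
        reg b rEps = Some (Z (int (slot n 1 0))) \<and>
        holds b 1 {..<L} (\<lambda>i. int ((f ^^ i) x)) \<and> tm b \<le> tm a + 9 * n + 6)"
      apply (rule runs_block)
       apply (use b' L in \<open>simp add: simps\<close>)
      apply (use b' L in \<open>simp add: simps\<close>)
      done
    then show "atest (Less rZero ru) b = Some False \<and> runs (block [Move rN ri, Move rEps rQ]) (atick b)
        (\<lambda>b. reg b rN = Some (Z (int L)) \<and> reg b rEps = Some (Z (int (slot n 1 0))) \<and>
          holds b 1 {..<L} (\<lambda>i. int ((f ^^ i) x)) \<and> tm b \<le> tm a + 9 * n + 6)"
      using b' by (simp add: simps)
  qed (use that in auto)
  show ?thesis
    unfolding output_cycle_def
    by (rule runs_Seq, rule runs_mono[OF init], rule runs_Seq, rule loop)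
qed

end

text \<open>The horizon stays within \<open>16 * d * K\<close>. For such \<open>T\<close> the
  numbers of the second run reach at most \<open>T^2 + 10 * T^3 * K\<close>, which is below
  \<open>11 * T^3 * K\<close>.\<close>

locale sized = rounding +
  fixes K d :: nat
  assumes g_bound: "e \<in> parcs G \<Longrightarrow> \<bar>g e\<bar> \<le> int K" and K_pos: "1 \<le> K" and d_pos: "1 \<le> d"
    and hop: "u \<in> pverts G \<Longrightarrow> v \<in> pverts G \<Longrightarrow> \<exists>q. awalk u q v \<and> length q \<le> d"
    and n_le: "n \<le> card (parcs G)" and has_cycle: "\<exists>c. cycle c"
    and bound_ge_cube: "11 * int (16 * d * K) ^ 3 * int K \<le> bound"
begin

text \<open>
  \<open>M / T\<close> is at most \<open>1\<close> above every cycle mean of \<open>g\<close>, and \<open>\<pi>\<close> certifies that a cycle of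
  successor pointers has mean at most \<open>M / T\<close>.
\<close>

definition certified :: "nat \<Rightarrow> (nat \<Rightarrow> nat) \<Rightarrow> bool" where
  "certified T f \<longleftrightarrow> (\<exists>\<pi> M. (\<forall>v\<in>{1..n}. f v \<noteq> 0 \<longrightarrow> (v, f v) \<in> parcs G \<and> int T * g (v, f v) - M + \<pi> (f v) \<le> \<pi> v) \<and>
     (\<forall>c. cycle c \<longrightarrow> int (length c) * M \<le> int T * sum_list (map g c) + int T * int (length c)))"

text \<open>The mean of \<open>g\<close> over \<open>\<sigma>\<close> is at most
  \<open>M / T\<close>, hence at most 1 above that over \<open>c\<close>. Rounding down adds less
  than one further unit. Two units of \<open>\<epsilon> / 2\<close> make the error
  \<open>\<epsilon>\<close>.\<close>

lemma certified_cycle_mean: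
  assumes cert: "certified T f" and T: "0 < T" and \<sigma>: "cycle \<sigma>" "\<And>e. e \<in> set \<sigma> \<Longrightarrow> snd e = f (fst e) \<and> f (fst e) \<noteq> 0"
    and c: "cycle c"
  shows "mean_weight w \<sigma> \<le> mean_weight w c + \<epsilon>"
proof -
  obtain \<pi> M where M: "\<And>v. v \<in> {1..n} \<Longrightarrow> f v \<noteq> 0 \<Longrightarrow> int T * g (v, f v) - M + \<pi> (f v) \<le> \<pi> v"
    "int (length c) * M \<le> int T * sum_list (map g c) + int T * int (length c)"
    using cert c unfolding certified_def by blast
  obtain u where u: "awalk u \<sigma> u" and ne: "\<sigma> \<noteq> []" using \<sigma>(1) by (auto simp: cycle_def)
  have cne: "c \<noteq> []" using c by (auto simp: cycle_def)
  have "sum_list (map (\<lambda>e. int T * g e - M) \<sigma>) \<le> 0"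
  proof (rule sum_list_le_telescope)
    fix e assume e: "e \<in> set \<sigma>"
    then have "e \<in> parcs G" using u by (auto simp: awalk_def)
    then have "fst e \<in> {1..n}" using arc_verts[of "fst e" "snd e"] by simp
    then show "int T * g e - M + \<pi> (snd e) \<le> \<pi> (fst e)"
      using M(1)[of "fst e"] \<sigma>(2)[OF e] by (cases e) auto
  qed (use awalk_sum_telescope[OF u, of \<pi>] in simp)
  then have "int T * sum_list (map g \<sigma>) \<le> int (length \<sigma>) * M"
    by (simp add: sum_list_affine)
  then have "int (length c) * (int T * sum_list (map g \<sigma>)) \<le> int (length c) * (int (length \<sigma>) * M)"
    by (intro mult_left_mono) auto
  also have "\<dots> = int (length \<sigma>) * (int (length c) * M)" by simp
  also have "\<dots> \<le> int (length \<sigma>) * (int T * sum_list (map g c) + int T * int (length c))"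
    by (intro mult_left_mono M(2)) auto
  finally have "int T * (int (length c) * sum_list (map g \<sigma>)) \<le> int T * (int (length \<sigma>) * (sum_list (map g c) + int (length c)))"
    by (simp add: algebra_simps)
  then have le: "int (length c) * sum_list (map g \<sigma>) \<le> int (length \<sigma>) * (sum_list (map g c) + int (length c))"
    using T by simp
  define A where "A = real_of_int (sum_list (map g \<sigma>))"
  define B where "B = real_of_int (sum_list (map g c))"
  define l where "l = real (length \<sigma>)"
  define k where "k = real (length c)"
  have pos: "0 < l" "0 < k" using ne cne by (auto simp: l_def k_def)
  have "real_of_int (int (length c) * sum_list (map g \<sigma>)) \<le> real_of_int (int (length \<sigma>) * (sum_list (map g c) + int (length c)))"
    using le by linarith
  then have "k * A \<le> l * (B + k)" by (simp add: A_def B_def l_def k_def)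
  then have means: "A / l \<le> B / k + 1" using pos by (simp add: field_simps)
  have up: "w e \<le> \<epsilon> / 2 * (real_of_int (g e) + 1)" and low: "\<epsilon> / 2 * real_of_int (g e) \<le> w e" for e
  proof -
    have "real_of_int (g e) \<le> 2 * w e / \<epsilon>" "2 * w e / \<epsilon> \<le> real_of_int (g e) + 1"
      unfolding g_def by linarith+
    then show "w e \<le> \<epsilon> / 2 * (real_of_int (g e) + 1)" "\<epsilon> / 2 * real_of_int (g e) \<le> w e"
      using eps by (auto simp: field_simps)
  qed
  have "(\<Sum>e\<leftarrow>\<sigma>. w e) \<le> (\<Sum>e\<leftarrow>\<sigma>. \<epsilon> / 2 * (real_of_int (g e) + 1))"
    by (intro sum_list_mono up)
  also have "\<dots> = \<epsilon> / 2 * (A + l)"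
    unfolding sum_list_const_mult by (simp add: sum_list_addf sum_list_triv A_def l_def sum_list_real_of_int)
  finally have "mean_weight w \<sigma> \<le> \<epsilon> / 2 * (A / l + 1)"
    using pos by (simp add: mean_weight_def l_def field_simps)
  also have "\<dots> \<le> \<epsilon> / 2 * (B / k + 2)"
    using means eps by (intro mult_left_mono) auto
  also have "\<dots> = \<epsilon> / 2 * B / k + \<epsilon>" by (simp add: field_simps)
  also have "\<epsilon> / 2 * B = (\<Sum>e\<leftarrow>c. \<epsilon> / 2 * real_of_int (g e))"
    unfolding sum_list_const_mult by (simp add: B_def sum_list_real_of_int)
  also have "\<dots> \<le> (\<Sum>e\<leftarrow>c. w e)" by (intro sum_list_mono low)
  finally show ?thesis using pos by (simp add: mean_weight_def k_def divide_right_mono)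
qed

text \<open>The upper limit on \<open>T0\<close> keeps the numbers below \<open>bound\<close>.
  \<open>certified\<close> holds on every such horizon; a nonzero end of the pointer walk is
  promised only from \<open>8 * d * K\<close> on.\<close>

lemma runs_attempt:
  assumes a: "base a" "reg a rT = Some (Z (int T0))" and T0: "1 \<le> T0" "2 * T0 \<le> 16 * d * K"
  defines "T \<equiv> 2 * T0"
  shows "runs attempt a (\<lambda>b. \<exists>f. base b \<and> reg b rT = Some (Z (int T)) \<and> holds b 2 {..n} (int \<circ> f) \<and>
    reg b rx = Some (Z (int ((f ^^ n) 1))) \<and> f 0 = 0 \<and> (\<forall>v\<le>n. f v \<le> n) \<and> certified T f \<and>
    (8 * d * K \<le> T \<longrightarrow> (f ^^ n) 1 \<noteq> 0) \<and> tm b \<le> tm a + 500 * (card (parcs G) * T))"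
proof -
  note simps = exec_simps base_def params_def holds_def
  have T: "1 \<le> T" "T \<le> 16 * d * K" using T0 by (auto simp: T_def)
  define k where "k = int K"
  define t where "t = int T"
  define R1 where "R1 = k + t"
  have k1: "1 \<le> k" and t1: "1 \<le> t" using K_pos T by (auto simp: k_def t_def)
  have "t ^ 3 * k \<le> int (16 * d * K) ^ 3 * k"
    using T k1 unfolding t_def by (intro mult_right_mono power_mono) (auto simp: of_nat_le_iff simp del: of_nat_mult)
  then have cube: "11 * (t * t * t * k) \<le> bound"
    using bound_ge_cube by (simp add: k_def power3_eq_cube)
  have mono: "t \<le> t * k" "k \<le> t * k" "t * k \<le> t * t * k" "t * t * k \<le> t * t * t * k" "t \<le> t * t" "t * t \<le> t * t * k"
  proof -
    have l: "x \<le> t * x" and r: "x \<le> x * k" if "0 \<le> x" for x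
      using mult_right_mono[OF t1 that] mult_left_mono[OF k1 that] by simp_all
    have "0 \<le> t" "0 \<le> k" "0 \<le> t * k" "0 \<le> t * (t * k)" "0 \<le> t * t" using t1 k1 by simp_all
    then show "t \<le> t * k" "k \<le> t * k" "t * k \<le> t * t * k" "t * t * k \<le> t * t * t * k" "t \<le> t * t" "t * t \<le> t * t * k"
      using l[of k] l[of t] r[of t] l[of "t * k"] l[of "t * (t * k)"] r[of "t * t"] by (simp_all add: mult.assoc)
  qed
  have R1: "R1 \<le> 2 * (t * k)" using mono by (simp add: R1_def)
  interpret phase1: bf_run G n eo w bound \<epsilon> T 1 t 0 R1
  proof unfold_locales
    fix e assume "e \<in> parcs G"
    then have "\<bar>g e\<bar> \<le> k" using g_bound by (simp add: k_def)
    then show "\<bar>g e\<bar> \<le> bound" "\<bar>1 * g e\<bar> \<le> bound" "\<bar>1 * g e - t\<bar> \<le> R1"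
      using mono cube t1 k1 unfolding R1_def by linarith+
  next
    have "int (T + 1) * R1 \<le> (2 * t) * (2 * (t * k))"
      using t1 k1 R1 by (intro mult_mono) (auto simp: t_def R1_def)
    moreover have "(2 * t) * (2 * (t * k)) = 4 * (t * t * k)" by simp
    ultimately show "\<bar>0\<bar> + int (T + 1) * R1 \<le> bound" using mono cube t1 k1 by linarith
    show "int T \<le> bound" using mono cube t1 k1 unfolding t_def[symmetric] by linarith
    show "0 \<le> R1" using k1 t1 by (simp add: R1_def)
  qed (rule n_le)
  have p0: "phase1.p0 = (\<lambda>_. 0)" by (auto simp: phase1.p0_def)
  have attempt1: "runs (block [Arith Add rT rT rT, Const rS 1, Move rM rT, Const rB 0]) a
      (\<lambda>b. base b \<and> params T 1 t 0 b \<and> tm b = tm a + 4)"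
    apply (rule runs_block)
     apply (use a phase1.T_le in \<open>simp add: simps T_def t_def\<close>)
    apply (use a in \<open>simp add: simps T_def t_def\<close>)
    done
  define post where "post b \<longleftrightarrow> (\<exists>f. base b \<and> reg b rT = Some (Z (int T)) \<and> holds b 2 {..n} (int \<circ> f) \<and>
    reg b rx = Some (Z (int ((f ^^ n) 1))) \<and> f 0 = 0 \<and> (\<forall>v\<le>n. f v \<le> n) \<and> certified T f \<and>
    (8 * d * K \<le> T \<longrightarrow> (f ^^ n) 1 \<noteq> 0) \<and> tm b \<le> tm a + 500 * (card (parcs G) * T))" for b
  have "runs (Seq (block [Arith Mul rB rT rT, Arith Add rM rB rmin, Arith Add rM rM rT, Move rS rT])
      (Seq bellman_ford follow)) c post"
    if b: "tm b = tm a + 4" and c: "phase1.bf_post b T c" for b c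
  proof -
    obtain mn where mn: "base c" "params T 1 t 0 c" "reg c rmin = Some (Z mn)"
      "0 < T \<longrightarrow> (\<forall>i\<in>{1..n}. mn \<le> pot (\<lambda>e. 1 * g e - t) (\<lambda>_. 0) T i)" "mn \<le> 0"
      "mn = 0 \<or> (\<exists>i\<in>{1..n}. pot (\<lambda>e. 1 * g e - t) (\<lambda>_. 0) T i \<le> mn)"
      and c_time: "tm c \<le> tm b + 100 * card (parcs G) * (T + 1)"
      using c unfolding phase1.bf_post_def p0 by blast
    have mn_ge: "- (2 * (t * t * k)) \<le> mn"
    proof -
      have "- (t * R1) \<le> mn" if i: "i \<in> {1..n}" "pot (\<lambda>e. 1 * g e - t) (\<lambda>_. 0) T i \<le> mn" for i
      proof -
        have "\<bar>pot (\<lambda>e. 1 * g e - t) (\<lambda>_. 0) T i\<bar> \<le> 0 + int T * R1"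
          using phase1.R i by (intro pot_abs_le) (auto simp: verts)
        then show ?thesis using i by (simp add: t_def)
      qed
      moreover have "t * R1 \<le> t * (2 * (t * k))" using R1 t1 by (intro mult_left_mono) auto
      moreover have "t * (2 * (t * k)) = 2 * (t * t * k)" by simp
      moreover have "0 \<le> t * t * k" using t1 k1 by simp
      ultimately show ?thesis using mn(6) by force
    qed
    define M where "M = t * t + mn + t"
    \<comment> \<open>\<open>T * g\<close> contributes at most \<open>T * K\<close> and
      \<open>M\<close> at most \<open>4 * T^2 * K\<close>: \<open>T * T\<close>, \<open>T\<close>,
      and \<open>2 * T^2 * K\<close> from \<open>mn_ge\<close>.\<close>
    define R2 where "R2 = 5 * (t * t * k)"
    have M_abs: "\<bar>M\<bar> \<le> 4 * (t * t * k)" using mono mn_ge mn(5) t1 k1 unfolding M_def by linarith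
    have c_bound: "t * t \<le> bound" "\<bar>t * t + mn\<bar> \<le> bound" "\<bar>M\<bar> \<le> bound"
      using mono cube mn_ge mn(5) M_abs t1 k1 by linarith+
    interpret phase2: bf_run G n eo w bound \<epsilon> T t M "t * t" R2
    proof unfold_locales
      fix e assume "e \<in> parcs G"
      then have ge: "\<bar>g e\<bar> \<le> k" using g_bound by (simp add: k_def)
      then have "\<bar>t * g e\<bar> \<le> t * k" using t1 by (simp add: abs_mult)
      then show "\<bar>g e\<bar> \<le> bound" "\<bar>t * g e\<bar> \<le> bound" "\<bar>t * g e - M\<bar> \<le> R2"
        using mono cube t1 k1 M_abs ge unfolding R2_def by linarith+
    next
      have "int (T + 1) * R2 \<le> (2 * t) * R2"
        using t1 k1 by (intro mult_right_mono) (auto simp: t_def R2_def)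
      moreover have "(2 * t) * R2 = 10 * (t * t * t * k)" by (simp add: R2_def)
      ultimately show "\<bar>t * t\<bar> + int (T + 1) * R2 \<le> bound" using mono cube t1 by linarith
      show "int T \<le> bound" by (rule phase1.T_le)
      show "0 \<le> R2" using k1 t1 by (simp add: R2_def)
    qed (rule n_le)
    have p0': "phase2.p0 = (\<lambda>u. if u = 1 then 0 else int T * int T)" 
      by (rule ext) (simp only: phase2.p0_def t_def[symmetric])
    have set_up: "runs (block [Arith Mul rB rT rT, Arith Add rM rB rmin, Arith Add rM rM rT, Move rS rT]) c
        (\<lambda>e. base e \<and> params T t M (t * t) e \<and> tm e = tm c + 4)"
      apply (rule runs_block)
       apply (use mn(1-3) c_bound phase1.T_le in \<open>simp add: simps t_def M_def\<close>)
      apply (use mn(1-3) in \<open>simp add: simps t_def M_def\<close>)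
      done
    have finish: "runs follow h post" if h: "phase2.bf_post e T h" and e: "tm e = tm c + 4" for e h
    proof -
      obtain f where f: "base h" "params T t M (t * t) h" "holds h 2 {..n} (int \<circ> f)"
        "phase2.tight (phase2.pt T) (phase2.pt T) f" and h_time: "tm h \<le> tm e + 100 * card (parcs G) * (T + 1)"
        using h unfolding phase2.bf_post_def by blast
      have f0: "f 0 = 0" and f_arc: "\<And>v. v \<in> {1..n} \<Longrightarrow> f v = 0 \<and> phase2.pt T v = phase2.p0 v \<or>
          (v, f v) \<in> parcs G \<and> t * g (v, f v) - M + phase2.pt T (f v) \<le> phase2.pt T v"
        using f(4) unfolding phase2.tight_def by blast+
      have f_le: "f v \<le> n" if "v \<le> n" for v
        using f0 f_arc[of v] arc_verts[of v "f v"] that by (cases "v = 0") auto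
      have "certified T f"
        unfolding certified_def
      proof (intro exI[of _ "phase2.pt T"] exI[of _ M] conjI ballI allI impI)
        fix v assume "v \<in> {1..n}" "f v \<noteq> 0"
        then show "(v, f v) \<in> parcs G" "int T * g (v, f v) - M + phase2.pt T (f v) \<le> phase2.pt T v"
          using f_arc[of v] by (auto simp: t_def)
      next
        fix c assume "cycle c"
        then have "int (length c) * mn \<le> int T * sum_list (map (\<lambda>e. 1 * g e - t) c)"
          using mn(4) T by (intro cycle_lower_bound) (auto simp: verts)
        then have "int (length c) * mn \<le> t * (sum_list (map g c) - int (length c) * t)"
          unfolding sum_list_affine by (simp add: t_def)
        then show "int (length c) * M \<le> int T * sum_list (map g c) + int T * int (length c)"
          by (simp add: M_def t_def algebra_simps)
      qed
      moreover have "(f ^^ n) 1 \<noteq> 0" if long: "8 * d * K \<le> T"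
      proof -
        obtain c0 where c0: "cycle c0" using has_cycle by blast
        obtain \<nu> :: real and c where \<nu>: "cycle c" "real_of_int (sum_list (map g c)) = \<nu> * length c"
          "\<And>c. cycle c \<Longrightarrow> \<nu> * length c \<le> real_of_int (sum_list (map g c))"
          by (rule exists_cycle_min_mean[OF c0, of g], rule that)
        obtain u where u: "awalk u c u" "c \<noteq> []" using \<nu>(1) by (auto simp: cycle_def)
        have g_real: "- real K \<le> real_of_int (g e)" "real_of_int (g e) \<le> real K" if "e \<in> set c" for e
          using g_bound[of e] that u by (auto simp: awalk_def abs_le_iff)
        have len: "0 < real (length c)" using u(2) by simp
        have "length c * - real K \<le> (\<Sum>e\<leftarrow>c. real_of_int (g e))" "(\<Sum>e\<leftarrow>c. real_of_int (g e)) \<le> length c * real K"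
          by (rule sum_list_map_ge sum_list_map_le, rule g_real, assumption)+
        then have "length c * - real K \<le> length c * \<nu>" "length c * \<nu> \<le> length c * real K"
          unfolding sum_list_real_of_int[symmetric] \<nu>(2) by (simp_all add: mult.commute)
        then have \<nu>_bounds: "- real K \<le> \<nu>" "\<nu> \<le> real K"
          unfolding mult_le_cancel_left_pos[OF len] by simp_all
        \<comment> \<open>\<open>K \<le> T\<close> yields \<open>\<nu> \<le> T\<close>, which is the
          condition \<open>\<nu> \<le> M\<close> of \<open>pot_ge_of_long_horizon\<close> for the
          first run.\<close>
        have "K \<le> 8 * d * K" using d_pos by simp
        then have KT: "K \<le> T" using long by (rule order_trans)
        have pot_ge: "T * (\<nu> - real_of_int t) - 2 * real d * real_of_int k \<le>
            real_of_int (pot (\<lambda>e. g e - t) (\<lambda>_. 0) T i)" if "i \<in> {1..n}" for i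
          by (rule pot_ge_of_long_horizon[OF hop]) (use \<nu>(3) \<nu>_bounds KT that g_bound in \<open>auto simp: t_def k_def verts\<close>)
        have mn_ge': "T * (\<nu> - real_of_int t) - 2 * real d * real_of_int k \<le> real_of_int mn"
          using mn(6)
        proof
          assume "mn = 0"
          have "T * (\<nu> - real_of_int t) \<le> 0"
            using \<nu>_bounds KT by (intro mult_nonneg_nonpos) (auto simp: t_def)
          moreover have "0 \<le> 2 * real d * real_of_int k" using k1 by simp
          ultimately show ?thesis using \<open>mn = 0\<close> by linarith
        next
          assume "\<exists>i\<in>{1..n}. pot (\<lambda>e. 1 * g e - t) (\<lambda>_. 0) T i \<le> mn"
          then obtain i where "i \<in> {1..n}" "pot (\<lambda>e. g e - t) (\<lambda>_. 0) T i \<le> mn" by auto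
          then show ?thesis using pot_ge[of i] by linarith
        qed
        have M_ge: "T * (\<nu> + 1) - 2 * real d * real_of_int k \<le> real_of_int M"
          using mn_ge' by (simp add: M_def t_def algebra_simps)
        have less: "phase2.pt T v < phase2.p0 v" if "v \<in> {1..n}" for v
          unfolding p0' unfolding t_def
        proof (rule pot_less_of_long_horizon[where W = k and d = d and \<nu> = \<nu> and c = c])
          have "int (8 * d * K) \<le> int T" using long by linarith
          then show "8 * int d * k \<le> int T" by (simp add: k_def)
        qed (use hop g_bound k1 d_pos \<nu> \<nu>_bounds M_ge that n_pos in \<open>auto simp: k_def verts\<close>)
        \<comment> \<open>A potential strictly below its start value excludes the alternative of
          \<open>tight\<close> without pointer.\<close>
        have f_ne: "f v \<in> {1..n}" if "v \<in> {1..n}" for v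
          using f_arc[OF that] less[OF that] arc_verts[of v "f v"] by auto
        have "(f ^^ i) 1 \<in> {1..n}" for i
          using n_pos f_ne by (induction i) auto
        from this[of n] show ?thesis by auto
      qed
      moreover have "4 + (100 * card (parcs G) * (T + 1) + 4 + 100 * card (parcs G) * (T + 1)) + 4 * n + 3
          \<le> 500 * (card (parcs G) * T)"
      proof -
        have "card (parcs G) * 2 \<le> card (parcs G) * T"
          using T0 by (intro mult_left_mono) (auto simp: T_def)
        moreover have "100 * card (parcs G) * (T + 1) = 100 * (card (parcs G) * T) + 100 * card (parcs G)"
          by (simp add: algebra_simps)
        ultimately show ?thesis using n_le n_pos by linarith
      qed
      then have "tm h + 4 * n + 3 \<le> tm a + 500 * (card (parcs G) * T)"
        using h_time c_time b e by linarith
      ultimately show ?thesis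
        using f f0 f_le
        by (intro runs_mono[OF runs_follow[of h t f]]) (auto simp: post_def params_def t_def)
    qed
    show ?thesis
      apply (rule runs_Seq, rule runs_mono[OF set_up], elim conjE)
      apply (rule runs_Seq, rule runs_mono, erule (1) phase2.runs_bellman_ford)
      apply (erule (1) finish)
      done
  qed
  note second = this
  have "runs attempt a post"
    unfolding attempt_def
    apply (rule runs_Seq, rule runs_mono[OF attempt1], elim conjE)
    apply (rule runs_Seq, rule runs_mono, erule (1) phase1.runs_bellman_ford)
    apply (erule (1) second)
    done
  then show ?thesis unfolding post_def .
qed

lemma runs_program:
  assumes a: "reg a rN = Some (Z (int n))" "reg a rEps = Some (W (ereal \<epsilon>))"
  shows "runs program a (\<lambda>b. \<exists>vs. reg b rN = Some (Z (int (length vs))) \<and> reg b rEps = Some (Z (int (slot n 1 0))) \<and>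
    holds b 1 {..<length vs} (\<lambda>i. int (vs ! i)) \<and> length vs \<le> n \<and> cycle (zip vs (rotate1 vs)) \<and>
    (\<forall>c. cycle c \<longrightarrow> mean_weight w (zip vs (rotate1 vs)) \<le> mean_weight w c + \<epsilon>) \<and>
    tm b \<le> tm a + 17000 * (card (parcs G) * (d * K)))"
proof -
  note simps = exec_simps base_def holds_def
  let ?m = "card (parcs G)"
  \<comment> \<open>The factor 1001 reproduces itself under doubling: an attempt with horizon
    \<open>2 * T\<close> costs at most \<open>1000 * (m * T)\<close>, and adding 1001 and the loop
    test stays within \<open>2 * 1001\<close>. While \<open>x = 0\<close>, the bound
    \<open>T < 8 * d * K\<close> keeps the next horizon admissible.\<close>
  define inv where "inv b \<longleftrightarrow> (\<exists>T x. base b \<and> reg b rT = Some (Z (int T)) \<and> reg b rx = Some (Z (int x)) \<and>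
    1 \<le> T \<and> T \<le> 16 * d * K \<and> (x = 0 \<longrightarrow> T < 8 * d * K) \<and> tm b \<le> tm a + 9 + 1001 * (?m * T) \<and>
    (x \<noteq> 0 \<longrightarrow> (\<exists>f. holds b 2 {..n} (int \<circ> f) \<and> x = (f ^^ n) 1 \<and> f 0 = 0 \<and> (\<forall>v\<le>n. f v \<le> n) \<and> certified T f)))" for b
  define post where "post b \<longleftrightarrow> (\<exists>vs. reg b rN = Some (Z (int (length vs))) \<and> reg b rEps = Some (Z (int (slot n 1 0))) \<and>
    holds b 1 {..<length vs} (\<lambda>i. int (vs ! i)) \<and> length vs \<le> n \<and> cycle (zip vs (rotate1 vs)) \<and>
    (\<forall>c. cycle c \<longrightarrow> mean_weight w (zip vs (rotate1 vs)) \<le> mean_weight w c + \<epsilon>) \<and>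
    tm b \<le> tm a + 17000 * (?m * (d * K)))" for b
  define meas where "meas b = 16 * d * K - nat (case reg b rT of Some (Z z) \<Rightarrow> z | _ \<Rightarrow> 0)" for b :: astate
  have dK: "1 \<le> d * K" using d_pos K_pos by simp
  have dK_assoc: "8 * d * K = 8 * (d * K)" "16 * d * K = 16 * (d * K)" by simp_all
  have init: "runs (block [Const rZero 0, Const rOne 1, Const rTwo 2, Const rP 32,
        Arith Add rLen rN rOne, Arith Add rQ rP rLen, Arith Add rF rQ rLen, Const rT 1, Const rx 0]) a inv"
  proof (rule runs_block)
    let ?regs = "(reg a)(rZero \<mapsto> Z 0, rOne \<mapsto> Z 1, rTwo \<mapsto> Z 2, rP \<mapsto> Z 32, rLen \<mapsto> Z (int n + 1),
      rQ \<mapsto> Z (32 + (int n + 1)), rF \<mapsto> Z (32 + (int n + 1) + (int n + 1)), rT \<mapsto> Z 1, rx \<mapsto> Z 0)"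
    have "32 + (int n + 1) + (int n + 1) \<le> bound" "int n + 1 \<le> bound" using bound_slot by (auto simp: slot_def)
    then show "ablock [Const rZero 0, Const rOne 1, Const rTwo 2, Const rP 32,
        Arith Add rLen rN rOne, Arith Add rQ rP rLen, Arith Add rF rQ rLen, Const rT 1, Const rx 0] a
        = Some (a\<lparr>reg := ?regs, tm := tm a + 9\<rparr>)"
      using a by (simp add: simps)
    have "(1 :: nat) < 8 * d * K" "1 \<le> 16 * d * K" using dK dK_assoc by linarith+
    then show "inv (a\<lparr>reg := ?regs, tm := tm a + 9\<rparr>)"
      unfolding inv_def using a by (intro exI[of _ 1] exI[of _ 0]) (auto simp: simps slot_def)
  qed
  have loop: "runs (While (Less rx rOne) attempt) b (\<lambda>b. runs output_cycle b post)" if "inv b" for b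
  proof (rule runs_While[where I = inv and meas = meas])
    fix b assume "inv b"
    then obtain T x where b: "base b" "reg b rT = Some (Z (int T))" "reg b rx = Some (Z (int x))"
      "1 \<le> T" "T \<le> 16 * d * K" "x = 0 \<longrightarrow> T < 8 * d * K" "tm b \<le> tm a + 9 + 1001 * (?m * T)"
      and x: "x \<noteq> 0 \<longrightarrow> (\<exists>f. holds b 2 {..n} (int \<circ> f) \<and> x = (f ^^ n) 1 \<and> f 0 = 0 \<and> (\<forall>v\<le>n. f v \<le> n) \<and> certified T f)"
      unfolding inv_def by (elim exE conjE) (rule that; assumption)
    show "(atest (Less rx rOne) b = Some True \<and> runs attempt (atick b) (\<lambda>c. inv c \<and> meas c < meas b)) \<or>
      (atest (Less rx rOne) b = Some False \<and> runs output_cycle (atick b) post)"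
    proof (cases "x = 0")
      case True
      have T_less: "T < 8 * d * K" using b(6) True by simp
      then have T_le: "2 * T \<le> 16 * d * K" "1 \<le> 2 * T" using dK_assoc b(4) by linarith+
      have "runs attempt (atick b) (\<lambda>c. inv c \<and> meas c < meas b)"
      proof (rule runs_mono[OF runs_attempt[of "atick b" T]], goal_cases)
        case (5 c)
        then obtain f where f: "base c" "reg c rT = Some (Z (int (2 * T)))" "holds c 2 {..n} (int \<circ> f)"
          "reg c rx = Some (Z (int ((f ^^ n) 1)))" "f 0 = 0" "\<forall>v\<le>n. f v \<le> n" "certified (2 * T) f"
          "8 * d * K \<le> 2 * T \<longrightarrow> (f ^^ n) 1 \<noteq> 0" and time: "tm c \<le> tm (atick b) + 500 * (?m * (2 * T))"
          by (elim exE conjE) (rule that; assumption)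
        have "1 \<le> ?m * T" using n_le n_pos b(4) by simp
        then have time': "tm c \<le> tm a + 9 + 1001 * (?m * (2 * T))"
          using time b(7) by (simp del: One_nat_def)
        have T_small: "2 * T < 8 * d * K" if "(f ^^ n) 1 = 0"
          using f(8) that by (meson not_le)
        have "inv c"
          unfolding inv_def
          by (intro exI[of _ "2 * T"] exI[of _ "(f ^^ n) 1"] exI[of _ f] conjI impI f(1-7) time' T_le T_small refl)
        moreover have "meas c < meas b" using f(2) b T_less dK_assoc by (auto simp: meas_def)
        ultimately show ?case by blast
      qed (use b(1,2,4) T_le(1) in \<open>simp_all add: base_def\<close>)
      then show ?thesis using b True by (simp add: simps)
    next
      case False
      then obtain f where f: "holds b 2 {..n} (int \<circ> f)" "x = (f ^^ n) 1" "f 0 = 0" "\<forall>v\<le>n. f v \<le> n" "certified T f"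
        using mp[OF x False] by (elim exE conjE) (rule that; assumption)
      obtain L where L: "0 < L" "L \<le> n" "(f ^^ L) x = x" "inj_on (\<lambda>i. (f ^^ i) x) {..<L}" "\<And>i. (f ^^ i) x \<in> {1..n}"
        by (rule funpow_periodic[OF f(3) _ n_pos f(2) False]) (use f(4) that in auto)
      define vs where "vs = map (\<lambda>i. (f ^^ i) x) [0..<L]"
      have arcs: "((f ^^ i) x, (f ^^ Suc i) x) \<in> parcs G" for i
        using f(5) L(5)[of i] L(5)[of "Suc i"] unfolding certified_def by (auto simp: Suc_le_eq)
      have cyc: "cycle (zip vs (rotate1 vs))"
        "set (zip vs (rotate1 vs)) \<subseteq> range (\<lambda>i. ((f ^^ i) x, (f ^^ Suc i) x))"
        unfolding vs_def using cycle_of_funpow[OF L(1,3,4) arcs] by auto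
      have opt: "mean_weight w (zip vs (rotate1 vs)) \<le> mean_weight w c + \<epsilon>" if "cycle c" for c
      proof (rule certified_cycle_mean[OF f(5) _ cyc(1) _ that])
        fix e assume "e \<in> set (zip vs (rotate1 vs))"
        then obtain i where "e = ((f ^^ i) x, (f ^^ Suc i) x)" using cyc(2) by blast
        then show "snd e = f (fst e) \<and> f (fst e) \<noteq> 0" using L(5)[of "Suc i"] by simp
      qed (use b in simp)
      have "runs output_cycle (atick b) post"
      proof (rule runs_mono[OF runs_output_cycle[of "atick b" f x L]], goal_cases)
        case (9 c)
        have "?m * T \<le> ?m * (16 * d * K)" using b(5) by (rule mult_left_mono) simp
        moreover have "?m \<le> ?m * (d * K)" using dK by simp
        moreover have "?m * (16 * d * K) = 16 * (?m * (d * K))" by simp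
        ultimately have "tm c \<le> tm a + 17000 * (?m * (d * K))"
          using 9 b(7) n_le n_pos atick_simps(3)[of b] by linarith
        moreover have "holds c 1 {..<length vs} (\<lambda>i. int (vs ! i))"
          using 9 by (simp add: holds_def vs_def)
        moreover have "length vs = L" by (simp add: vs_def)
        ultimately show ?case unfolding post_def using 9 L(2) cyc(1) opt by (intro exI[of _ vs]) simp
      qed (use b f L in \<open>auto simp: base_def holds_def\<close>)
      then show ?thesis using b False by (simp add: simps)
    qed
  qed (rule that)
  have "runs program a post"
    unfolding program_def by (rule runs_Seq, rule runs_mono[OF init], rule runs_Seq, rule loop)
  then show ?thesis unfolding post_def .
qed

end

section \<open>Graph parameters and numerical bounds\<close>

locale nat_digraph = pair_fin_digraph G for G :: "nat pair_pre_digraph"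
begin

lemma exists_apath:
  assumes "strongly_connected (with_proj G)" "u \<in> pverts G" "v \<in> pverts G"
  shows "\<exists>q. apath u q v"
  using assms unfolding strongly_connected_def by (auto simp: reachable_apath)

lemma short_awalk:
  assumes sc: "strongly_connected (with_proj G)" and uv: "u \<in> pverts G" "v \<in> pverts G"
  shows "\<exists>q. awalk u q v \<and> length q \<le> hop_diameter G"
proof -
  have "\<exists>k q. apath u q v \<and> length q = k" if "u \<in> pverts G" "v \<in> pverts G" for u v
    using exists_apath[OF sc that] by blast
  then have dist: "\<exists>q. apath u q v \<and> length q = hop_distance G u v"
    if "u \<in> pverts G" "v \<in> pverts G" for u v
    unfolding hop_distance_def by (rule LeastI_ex) (use that in auto)
  have "hop_distance G u v \<le> hop_diameter G"
    unfolding hop_diameter_def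
  proof (rule Max_ge)
    have "{hop_distance G u v |u v. u \<in> pverts G \<and> v \<in> pverts G}
        = (\<lambda>(u, v). hop_distance G u v) ` (pverts G \<times> pverts G)" by auto
    then show "finite {hop_distance G u v |u v. u \<in> pverts G \<and> v \<in> pverts G}"
      using pair_finite_verts by simp
  qed (use uv in blast)
  then show ?thesis using dist[OF uv] by (auto simp: apath_def)
qed

text \<open>Lets \<open>n\<close> replace the diameter in the bit length, whose bound mentions only
  \<open>n\<close> and \<open>wmax / \<epsilon>\<close>.\<close>

lemma hop_diameter_le:
  assumes sc: "strongly_connected (with_proj G)"
  shows "hop_diameter G \<le> card (pverts G)"
proof -
  have ne: "pverts G \<noteq> {}" using sc by (auto simp: strongly_connected_def)
  have eq: "{hop_distance G u v |u v. u \<in> pverts G \<and> v \<in> pverts G}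
      = (\<lambda>(u, v). hop_distance G u v) ` (pverts G \<times> pverts G)" by auto
  have "hop_distance G u v \<le> card (pverts G)" if uv: "u \<in> pverts G" "v \<in> pverts G" for u v
  proof -
    obtain q where q: "apath u q v" using exists_apath[OF sc uv] by blast
    then have "hop_distance G u v \<le> length q"
      unfolding hop_distance_def by (intro Least_le) auto
    also have "\<dots> \<le> card (pverts G)" using length_apath_less[OF q] by simp
    finally show ?thesis .
  qed
  then show ?thesis
    unfolding hop_diameter_def eq using pair_finite_verts ne by (subst Max_le_iff) auto
qed

text \<open>Every vertex has an outgoing arc: a walk to the tail of a fixed arc either starts with
  one or is empty, and then the fixed arc serves. This absorbs the work per vertex into
  \<open>m\<close>.\<close>

lemma card_verts_le_card_arcs:
  assumes sc: "strongly_connected (with_proj G)" and ne: "parcs G \<noteq> {}"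
  shows "card (pverts G) \<le> card (parcs G)"
proof -
  obtain e where e: "e \<in> parcs G" using ne by blast
  have "pverts G \<subseteq> fst ` parcs G"
  proof
    fix v assume v: "v \<in> pverts G"
    obtain q where q: "awalk v q (fst e)"
      using short_awalk[OF sc v arc_fst_in_verts[OF e]] by blast
    show "v \<in> fst ` parcs G"
      using q e by (cases q) (auto simp: awalk_Nil_iff awalk_Cons_iff)
  qed
  then have "card (pverts G) \<le> card (fst ` parcs G)"
    by (rule card_mono[rotated]) (simp add: pair_finite_arcs)
  also have "\<dots> \<le> card (parcs G)" by (rule card_image_le) (rule pair_finite_arcs)
  finally show ?thesis .
qed

lemma exists_cycle:
  assumes sc: "strongly_connected (with_proj G)" and ne: "parcs G \<noteq> {}"
  shows "\<exists>c. cycle c"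
proof -
  obtain e where e: "e \<in> parcs G" using ne by blast
  obtain q where q: "awalk (snd e) q (fst e)"
    using short_awalk[OF sc arc_snd_in_verts[OF e] arc_fst_in_verts[OF e]] by blast
  then have "closed_w (e # q)"
    unfolding closed_w_def using e by (intro exI[of _ "fst e"]) (auto simp: awalk_Cons_iff)
  then show ?thesis by (rule closed_w_imp_cycle)
qed

lemma min_mean_cycle_attained:
  assumes "\<exists>c. cycle c"
  shows "\<exists>c. cycle c \<and> min_mean_cycle G w = mean_weight w c"
proof -
  have "{mean_weight w p |p. cycle p} = mean_weight w ` {c. cycle c}" by auto
  moreover have "Min (mean_weight w ` {c. cycle c}) \<in> mean_weight w ` {c. cycle c}"
    using assms finite_cycles by (intro Min_in) auto
  ultimately show ?thesis unfolding min_mean_cycle_def by auto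
qed

end

text \<open>\<open>log 2 Y \<le> 3 / 2 * ln Y\<close> because \<open>ln 2 \<ge> 2 / 3\<close>; so
  the width is at most \<open>28 + 6 * ln Y\<close>, whence 34.\<close>

lemma int_width_le_ln:
  assumes x: "1 \<le> x" "real_of_int x \<le> 2 ^ 25 * Y ^ 4" and Y: "1 \<le> Y"
  shows "real (int_width x) \<le> 34 * max 1 (ln Y)"
proof -
  have "0 < x" using x by simp
  have "real_of_int (bitlen x) \<le> log 2 x + 1"
    using \<open>0 < x\<close> by (simp add: bitlen_alt_def)
  also have "log 2 x \<le> log 2 (2 ^ 25 * Y ^ 4)"
    using x Y by (subst log_le_cancel_iff) auto
  also have "\<dots> = log 2 (2 ^ 25) + log 2 (Y ^ 4)"
    using Y by (subst log_mult) auto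
  also have "log 2 (2 ^ 25) = 25"
    by (subst log_pow_cancel) auto
  also have "log 2 (Y ^ 4) = 4 * log 2 Y"
    using Y by (simp add: log_nat_power)
  also have "log 2 Y \<le> 3 / 2 * ln Y"
  proof -
    have "ln Y / ln 2 \<le> ln Y / (2 / 3)"
      using Y ln2_ge_two_thirds by (intro divide_left_mono) auto
    then show ?thesis by (simp add: log_def)
  qed
  finally have "real_of_int (bitlen x) \<le> 26 + 6 * ln Y" by simp
  moreover have "real (int_width x) = 2 + real_of_int (bitlen x)"
    using \<open>0 < x\<close> bitlen_nonneg[of x] by (simp add: int_width_def)
  ultimately show ?thesis by linarith
qed

lemma program_spec:
  fixes G :: "nat pair_pre_digraph" and w :: "nat \<times> nat \<Rightarrow> real" and n :: nat and wmax \<epsilon> :: real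
  assumes G: "pair_fin_digraph G" and verts: "pverts G = {1..n}" and arcs: "parcs G \<noteq> {}"
    and sc: "strongly_connected (with_proj G)" and w: "\<forall>e\<in>parcs G. w e \<in> {- wmax..wmax}"
    and eps: "0 < \<epsilon>" and eo: "is_edge_oracle G eo"
  defines "X \<equiv> max 1 (wmax / \<epsilon>)"
  shows "\<exists>s. run program n \<epsilon> eo (weight_oracle_of G w) = return_spmf s \<and>
    (\<exists>\<sigma>. outputs s \<sigma> \<and> pre_digraph.cycle (with_proj G) \<sigma> \<and> mean_weight w \<sigma> \<le> min_mean_cycle G w + \<epsilon>) \<and>
    num_cells s \<le> 38 * n \<and> real (width s) \<le> 34 * max 1 (ln (real n * X)) \<and>
    real (steps s) \<le> 68000 * (real (card (parcs G)) * max 1 (real (hop_diameter G)) * X)"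
proof -
  interpret nat_digraph G unfolding nat_digraph_def by (rule G)
  define d where "d = max 1 (hop_diameter G)"
  \<comment> \<open>\<open>|g| \<le> 2 * X + 1 \<le> 3 * X\<close> since \<open>X \<ge> 1\<close>,
    and rounding up stays below \<open>4 * X\<close>.\<close>
  define K where "K = nat \<lceil>3 * X\<rceil>"
  define bound where "bound = 11 * int (16 * d * K) ^ 3 * int K + int (slot n 3 0)"
  have n: "1 \<le> n" using arcs verts arc_fst_in_verts by fastforce
  have X: "1 \<le> X" by (simp add: X_def)
  have K: "1 \<le> K" "real K \<le> 4 * X" "3 * X \<le> real K"
    using X unfolding K_def by linarith+
  have d: "1 \<le> d" "d \<le> n" using hop_diameter_le[OF sc] n verts by (auto simp: d_def)
  have cube_nonneg: "0 \<le> 11 * int (16 * d * K) ^ 3 * int K" by simp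
  interpret rounding G n eo w bound \<epsilon>
  proof unfold_locales
    show "int (slot n 3 0) \<le> bound" using cube_nonneg unfolding bound_def by linarith
  qed (use verts n eo eps in auto)
  interpret sized G n eo w bound \<epsilon> K d
  proof unfold_locales
    show "n \<le> card (parcs G)" using card_verts_le_card_arcs[OF sc arcs] verts by simp
    show "\<exists>q. awalk u q v \<and> length q \<le> d" if "u \<in> pverts G" "v \<in> pverts G" for u v
      using short_awalk[OF sc that] by (auto simp: d_def le_max_iff_disj)
    show "11 * int (16 * d * K) ^ 3 * int K \<le> bound" unfolding bound_def by simp
    fix e assume "e \<in> parcs G"
    then have "\<bar>w e\<bar> \<le> wmax" using w by (auto simp: abs_le_iff)
    then have "\<bar>w e\<bar> / \<epsilon> \<le> wmax / \<epsilon>" using eps by (intro divide_right_mono) auto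
    then have "\<bar>2 * w e / \<epsilon>\<bar> \<le> 2 * X" using eps by (simp add: X_def abs_mult)
    then have "real_of_int \<bar>g e\<bar> \<le> real K" using X K(3) unfolding g_def by linarith
    then show "\<bar>g e\<bar> \<le> int K" by linarith
  qed (use K d exists_cycle[OF sc arcs] in auto)
  let ?a = "\<lparr>reg = [rN \<mapsto> Z (int n), rEps \<mapsto> W (ereal \<epsilon>)], arr = \<lambda>_ _. None, tm = 0\<rparr>"
  have "models (initial_state n \<epsilon>) ?a"
  proof -
    have "bit_length (of_nat n) \<le> int_width bound"
      using bit_length_of_int[of "int n"] int_width_mono[of "int n" bound] bound_ge(1)[of n] by simp
    then show ?thesis
      by (auto simp: models_def initial_state_def put_def lookup_def fun_eq_iff)
  qed
  note init = this
  have "runs program ?a (\<lambda>b. \<exists>vs. reg b rN = Some (Z (int (length vs))) \<and> reg b rEps = Some (Z (int (slot n 1 0))) \<and>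
    holds b 1 {..<length vs} (\<lambda>i. int (vs ! i)) \<and> length vs \<le> n \<and> cycle (zip vs (rotate1 vs)) \<and>
    (\<forall>c. cycle c \<longrightarrow> mean_weight w (zip vs (rotate1 vs)) \<le> mean_weight w c + \<epsilon>) \<and>
    tm b \<le> tm ?a + 17000 * (card (parcs G) * (d * K)))" (is "runs _ _ ?post")
    by (rule runs_program) simp_all
  then obtain s b where run: "run program n \<epsilon> eo (weight_oracle_of G w) = return_spmf s"
    and s: "models s b" and b: "?post b"
    using init unfolding runs_def run_def by blast
  obtain vs where vs: "reg b rN = Some (Z (int (length vs)))" "reg b rEps = Some (Z (int (slot n 1 0)))"
    "holds b 1 {..<length vs} (\<lambda>i. int (vs ! i))" "length vs \<le> n" "cycle (zip vs (rotate1 vs))"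
    "\<And>c. cycle c \<Longrightarrow> mean_weight w (zip vs (rotate1 vs)) \<le> mean_weight w c + \<epsilon>"
    and time: "tm b \<le> 17000 * (card (parcs G) * (d * K))"
    using b by auto
  have out: "outputs s (zip vs (rotate1 vs))"
    unfolding outputs_def
  proof (intro exI[of _ vs] exI[of _ "slot n 1 0"] conjI allI impI)
    fix i assume "i < length vs"
    moreover have "slot n 1 0 + i = slot n 1 i" by (simp add: slot_def)
    ultimately show "get_nat s (slot n 1 0 + i) = Some (vs ! i)"
      using vs(3,4) by (intro models_get_nat[OF s]) (simp add: anat_def aint_def holds_def)
  qed (use vs(1,2) in \<open>auto intro!: models_get_nat[OF s] simp: anat_def aint_def\<close>)
  have opt: "mean_weight w (zip vs (rotate1 vs)) \<le> min_mean_cycle G w + \<epsilon>"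
    using min_mean_cycle_attained[OF has_cycle, of w] vs(6) by auto
  \<comment> \<open>\<open>32 + 3 * (n + 1) \<le> 38 * n\<close> because
    \<open>n \<ge> 1\<close>.\<close>
  have cells: "num_cells s \<le> 38 * n"
  proof -
    have "dom (mem s) \<subseteq> {..<32 + 3 * Suc n}"
    proof
      fix l assume "l \<in> dom (mem s)"
      then have "lookup n b l \<noteq> None" using s by (auto simp: models_def)
      then have "l < 32 \<or> (l - 32) div Suc n < 3" unfolding lookup_def by (auto split: if_splits)
      then show "l \<in> {..<32 + 3 * Suc n}" by (auto simp: div_less_iff_less_mult)
    qed
    then have "card (dom (mem s)) \<le> card {..<32 + 3 * Suc n}" by (intro card_mono) auto
    then show ?thesis using n by (simp add: num_cells_def)
  qed
  \<comment> \<open>The cube contributes \<open>11 * 64^3 * 4 = 11534336\<close> and the addresses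
    at most 38, together below \<open>2^25\<close>.\<close>
  have bound_le: "real_of_int bound \<le> 2 ^ 25 * (real n * X) ^ 4"
  proof -
    define Y where "Y = real n * X"
    have Y: "real n \<le> Y" "1 \<le> Y" using n X mult_mono[of 1 "real n" 1 X] mult_left_mono[of 1 X "real n"] by (auto simp: Y_def)
    have Y4: "Y \<le> Y ^ 4" using Y by (simp add: self_le_power)
    have dK: "real (16 * d * K) \<le> 64 * Y"
    proof -
      have "real d * real K \<le> real n * (4 * X)" using d K X by (intro mult_mono) auto
      moreover have "real (16 * d * K) = 16 * (real d * real K)" "64 * Y = 16 * (real n * (4 * X))"
        by (simp_all add: Y_def)
      ultimately show ?thesis by linarith
    qed
    have "real K \<le> 4 * Y"
    proof -
      have "X \<le> Y" unfolding Y_def using X n by (simp add: mult_le_cancel_right1)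
      then show ?thesis using K(2) by linarith
    qed
    with dK have "real (16 * d * K) ^ 3 * real K \<le> (64 * Y) ^ 3 * (4 * Y)"
      using Y by (intro mult_mono power_mono) auto
    also have "\<dots> = 1048576 * Y ^ 4" by (simp add: power_mult_distrib eval_nat_numeral)
    finally have "11 * (real (16 * d * K) ^ 3 * real K) \<le> 11534336 * Y ^ 4" by linarith
    moreover have "real (slot n 3 0) \<le> 38 * Y ^ 4"
      using Y Y4 by (simp add: slot_def)
    moreover have "real_of_int bound = 11 * (real (16 * d * K) ^ 3 * real K) + real (slot n 3 0)"
      by (simp add: bound_def)
    ultimately have "real_of_int bound \<le> 33554432 * Y ^ 4" using Y Y4 by linarith
    then show ?thesis unfolding Y_def[symmetric] by simp
  qed
  have width: "real (width s) \<le> 34 * max 1 (ln (real n * X))"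
  proof -
    have "real (width s) \<le> real (int_width bound)" using s by (simp add: models_def)
    also have "\<dots> \<le> 34 * max 1 (ln (real n * X))"
      using bound_le bound_ge(3) n X mult_mono[of 1 "real n" 1 X] by (intro int_width_le_ln) auto
    finally show ?thesis .
  qed
  have "real (steps s) \<le> real (17000 * (card (parcs G) * (d * K)))"
    using s time unfolding models_def by (simp only: of_nat_le_iff)
  also have "\<dots> = 17000 * (real (card (parcs G)) * real d) * real K" by simp
  also have "\<dots> \<le> 17000 * (real (card (parcs G)) * real d) * (4 * X)"
    using K by (intro mult_left_mono) auto
  also have "\<dots> = 68000 * (real (card (parcs G)) * max 1 (real (hop_diameter G)) * X)"
    by (simp add: d_def max_def)
  finally show ?thesis
    using run out vs(5) opt cells width by blast
qed

text \<open>The outcome is a point mass, so expectation and tail both reduce to one deterministic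
  bound on \<open>steps\<close>. The constant 68000 is that of the step count and also covers 38 and
  34.\<close>

theorem theorem5p14:
  shows "\<exists>(P :: com) (C :: real). \<forall>(G :: nat pair_pre_digraph) (w :: nat \<times> nat \<Rightarrow> real)
           (n :: nat) (m :: nat) (d :: nat) (wmax :: real) (\<epsilon> :: real) (eo :: edge_oracle).
    pair_fin_digraph G \<and> pverts G = {1..n} \<and> m = card (parcs G) \<and> m > 0 \<and>
    strongly_connected (with_proj G) \<and> d = hop_diameter G \<and>
    (\<forall>e \<in> parcs G. w e \<in> {- wmax .. wmax}) \<and> \<epsilon> > 0 \<and> is_edge_oracle G eo \<longrightarrow>
    (let D = run P n \<epsilon> eo (weight_oracle_of G w);
         B = C * (real m * (max 1 (real d))\<^sup>2 * (max 1 (wmax / \<epsilon>))\<^sup>2 * max 1 (ln (real n)))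
     in lossless_spmf D \<and>
        (\<forall>s \<in> set_spmf D.
           (\<exists>\<sigma>. outputs s \<sigma> \<and> pre_digraph.cycle (with_proj G) \<sigma> \<and>
                mean_weight w \<sigma> \<le> min_mean_cycle G w + \<epsilon>) \<and>
           real (num_cells s) \<le> C * real n \<and>
           real (width s) \<le> C * max 1 (ln (real n * max 1 (wmax / \<epsilon>)))) \<and>
        (\<integral>\<^sup>+ s. ennreal (real (steps s)) \<partial>measure_spmf D) \<le> ennreal B \<and>
        (\<forall>\<alpha> \<in> {0<..<1}.
           measure (measure_spmf D) {s. real (steps s) \<le> B * max 1 (ln (1 / \<alpha>))} \<ge> 1 - \<alpha>))"
proof (intro exI[of _ program] exI[of _ "68000 :: real"] allI impI, elim conjE)
  fix G :: "nat pair_pre_digraph" and w n m d and wmax \<epsilon> :: real and eo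
  assume G: "pair_fin_digraph G" and verts: "pverts G = {1..n}" and m: "m = card (parcs G)" "0 < m"
    and sc: "strongly_connected (with_proj G)" and d: "d = hop_diameter G"
    and w: "\<forall>e\<in>parcs G. w e \<in> {- wmax..wmax}" and eps: "0 < \<epsilon>" and eo: "is_edge_oracle G eo"
  define X where "X = max 1 (wmax / \<epsilon>)"
  define \<delta> where "\<delta> = max 1 (real d)"
  define l where "l = max 1 (ln (real n))"
  define B where "B = 68000 * (real m * \<delta>\<^sup>2 * X\<^sup>2 * l)"
  have ge: "1 \<le> X" "1 \<le> \<delta>" "1 \<le> l" by (auto simp: X_def \<delta>_def l_def)
  have "parcs G \<noteq> {}" using m by auto
  then obtain s where run: "run program n \<epsilon> eo (weight_oracle_of G w) = return_spmf s"
    and cyc: "\<exists>\<sigma>. outputs s \<sigma> \<and> pre_digraph.cycle (with_proj G) \<sigma> \<and> mean_weight w \<sigma> \<le> min_mean_cycle G w + \<epsilon>"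
    and cells: "num_cells s \<le> 38 * n" and width: "real (width s) \<le> 34 * max 1 (ln (real n * X))"
    and steps: "real (steps s) \<le> 68000 * (real m * \<delta> * X)"
    using program_spec[OF G verts _ sc w eps eo] unfolding X_def \<delta>_def d m by blast
  have cells': "real (num_cells s) \<le> 68000 * real n" using cells by linarith
  have width': "real (width s) \<le> 68000 * max 1 (ln (real n * X))" using width by linarith
  \<comment> \<open>The steps are linear in \<open>\<delta>\<close> and \<open>X\<close>; the
    squares and the logarithm only enlarge the bound, as all these factors are at least 1.\<close>
  have "real m * \<delta> * X \<le> real m * \<delta>\<^sup>2 * X\<^sup>2"
    using ge by (intro mult_mono) (auto simp: power2_eq_square)
  also have "\<dots> \<le> real m * \<delta>\<^sup>2 * X\<^sup>2 * l"
    using ge mult_left_mono[of 1 l "real m * \<delta>\<^sup>2 * X\<^sup>2"] by simp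
  finally have B: "real (steps s) \<le> B" using steps by (simp add: B_def)
  have tail: "real (steps s) \<le> B * max 1 (ln (1 / \<alpha>))" for \<alpha>
  proof -
    have "0 \<le> B" using B by (rule order_trans[rotated]) simp
    then have "B * 1 \<le> B * max 1 (ln (1 / \<alpha>))" by (intro mult_left_mono) auto
    then show ?thesis using B by linarith
  qed
  show "let D = run program n \<epsilon> eo (weight_oracle_of G w);
         B = 68000 * (real m * (max 1 (real d))\<^sup>2 * (max 1 (wmax / \<epsilon>))\<^sup>2 * max 1 (ln (real n)))
     in lossless_spmf D \<and>
        (\<forall>s \<in> set_spmf D.
           (\<exists>\<sigma>. outputs s \<sigma> \<and> pre_digraph.cycle (with_proj G) \<sigma> \<and>
                mean_weight w \<sigma> \<le> min_mean_cycle G w + \<epsilon>) \<and>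
           real (num_cells s) \<le> 68000 * real n \<and>
           real (width s) \<le> 68000 * max 1 (ln (real n * max 1 (wmax / \<epsilon>)))) \<and>
        (\<integral>\<^sup>+ s. ennreal (real (steps s)) \<partial>measure_spmf D) \<le> ennreal B \<and>
        (\<forall>\<alpha> \<in> {0<..<1}.
           measure (measure_spmf D) {s. real (steps s) \<le> B * max 1 (ln (1 / \<alpha>))} \<ge> 1 - \<alpha>)"
    unfolding Let_def run X_def[symmetric] \<delta>_def[symmetric] l_def[symmetric] B_def[symmetric]
    using cyc cells' width' B tail
    by (auto simp: measure_spmf_return_spmf nn_integral_return measure_return ennreal_leI indicator_def)
qed

end
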